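(* If $\mathcal{V}\subseteq\mathcal{B}(H)$ is an approximately $H$-injective masa-bimodule and $\mathcal{U}\subseteq\mathcal{B}(H)$ is a hyperreflexive masa-bimodule, then the intersection $\mathcal{W}=\mathcal{U}\cap\mathcal{V}$ is hyperreflexive and $$k(\mathcal{W})\leq\lambda_H(\mathcal{V})+k(\mathcal{U})+\lambda_H(\mathcal{V})\,k(\mathcal{U}).$$
   Context: $H$ is a separable Hilbert space, $\mathcal{B}(H)$ is the space of bounded linear operators on $H$ with the operator norm, and $\mathcal{D}\subseteq\mathcal{B}(H)$ is a fixed maximal abelian selfadjoint algebra (masa). A masa-bimodule ($\mathcal{D}$-bimodule) is a weak* closed subspace $\mathcal{X}\subseteq\mathcal{B}(H)$ with $\mathcal{D}\mathcal{X}\mathcal{D}\subseteq\mathcal{X}$. For a subspace $\mathcal{X}\subseteq\mathcal{B}(H)$ and $T\in\mathcal{B}(H)$, put $d(T,\mathcal{X})=\inf_{X\in\mathcal{X}}\|T-X\|$ and $\alpha(T,\mathcal{X})=\sup\{\inf_{X\in\mathcal{X}}\|T\xi-X\xi\| : \xi\in H,\ \|\xi\|=1\}$. A weak* closed subspace $\mathcal{X}$ is hyperreflexive if there is $k>0$ with $d(T,\mathcal{X})\leq k\,\alpha(T,\mathcal{X})$ for all $T\in\mathcal{B}(H)$; the least (infimal) such $k$ is denoted $k(\mathcal{X})$. A Schur idempotent is a weak* continuous $\mathcal{D}$-bimodule (linear) map $\Phi$ on $\mathcal{B}(H)$ with $\Phi\circ\Phi=\Phi$; $\|\Phi\|$ is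 its norm as a linear map on $\mathcal{B}(H)$. Put $\Phi^\perp=\mathrm{id}-\Phi$, let $\operatorname{Ran}\Phi$ be the range of $\Phi$, and write $\Phi\leq\Psi$ if $\Phi\Psi=\Phi$. $\mathfrak{H}$ is the set of Schur idempotents $\Phi$ for which there is $\lambda>0$ with $\|\Phi^\perp(T)\|\leq\lambda\,\alpha(T,\operatorname{Ran}\Phi)$ for all $T\in\mathcal{B}(H)$; the least (infimal) such $\lambda$ is denoted $\lambda(\Phi)$. A sequence $(\Phi_n)_{n\in\mathbb{N}}$ of Schur idempotents with $\sup_n\|\Phi_n\|<\infty$ decreases to a subspace $\mathcal{V}$ if $\Phi_1\geq\Phi_2\geq\cdots$ and $\mathcal{V}=\bigcap_n\operatorname{Ran}\Phi_n$. A masa-bimodule $\mathcal{V}$ is approximately $H$-injective if there is such a uniformly bounded sequence $(\Phi_n)$ decreasing to $\mathcal{V}$ with $\Phi_n\in\mathfrak{H}$ for each $n$ and $\sup_n\lambda(\Phi_n)<\infty$; the infimum of the possible values of $\sup_n\lambda(\Phi_n)$ over all such sequences is denoted $\lambda_H(\mathcal{V})$. *)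

theory Defs
  imports "HOL-Analysis.Analysis"
begin

section \<open>Complex Hilbert spaces\<close>

class complex_vector = real_vector +
  fixes scaleC :: "complex \<Rightarrow> 'a \<Rightarrow> 'a" (infixr "*\<^sub>C" 75)
  assumes scaleC_add_right: "a *\<^sub>C (x + y) = a *\<^sub>C x + a *\<^sub>C y"
    and scaleC_add_left: "(a + b) *\<^sub>C x = a *\<^sub>C x + b *\<^sub>C x"
    and scaleC_scaleC: "a *\<^sub>C b *\<^sub>C x = (a * b) *\<^sub>C x"
    and scaleC_one: "1 *\<^sub>C x = x"
    and scaleR_scaleC: "r *\<^sub>R x = complex_of_real r *\<^sub>C x"

global_interpretation complex_vector:
  vector_space "scaleC :: complex \<Rightarrow> 'a \<Rightarrow> 'a::complex_vector"
  by unfold_locales (simp_all add: scaleC_add_right scaleC_add_left scaleC_scaleC scaleC_one)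

abbreviation csubspace :: "'a::complex_vector set \<Rightarrow> bool"
  where "csubspace \<equiv> module.subspace scaleC"

abbreviation clinear :: "('a::complex_vector \<Rightarrow> 'b::complex_vector) \<Rightarrow> bool"
  where "clinear \<equiv> Vector_Spaces.linear scaleC scaleC"

text \<open>
  The inner product is linear in its first argument. The real inner product inherited from
  \<^class>\<open>real_inner\<close> is its real part, so positive definiteness, the norm and the metric are
  the ones of \<^class>\<open>real_inner\<close>: the norm of \<open>x\<close> is the square root of \<open>cinner x x\<close>.
\<close>

class chilbert_space = complex_vector + real_inner + complete_space +
  fixes cinner :: "'a \<Rightarrow> 'a \<Rightarrow> complex"
  assumes cinner_commute: "cinner x y = cnj (cinner y x)"
    and cinner_add_left: "cinner (x + y) z = cinner x z + cinner y z"
    and cinner_scaleC_left: "cinner (a *\<^sub>C x) y = a * cinner x y"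
    and inner_eq_Re_cinner: "inner x y = Re (cinner x y)"


lemma norm_scaleC: "norm (a *\<^sub>C x) = cmod a * norm (x::'a::chilbert_space)"
proof -
  have im: "Im (cinner x x) = 0"
    using arg_cong[OF cinner_commute[of x x], of Im] by simp
  have "cinner (a *\<^sub>C x) (a *\<^sub>C x) = a * cnj (cinner (a *\<^sub>C x) x)"
    by (metis cinner_commute cinner_scaleC_left)
  also have "\<dots> = (a * cnj a) * cinner x x"
    by (metis cinner_commute cinner_scaleC_left complex_cnj_mult mult.assoc)
  also have "\<dots> = of_real ((cmod a)\<^sup>2) * cinner x x"
    by (simp only: complex_norm_square[symmetric] of_real_power)
  finally have "inner (a *\<^sub>C x) (a *\<^sub>C x) = (cmod a)\<^sup>2 * inner x x"
    using im by (simp add: inner_eq_Re_cinner)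
  then have "(norm (a *\<^sub>C x))\<^sup>2 = (cmod a * norm x)\<^sup>2"
    by (simp add: power2_norm_eq_inner power_mult_distrib)
  then show ?thesis
    by simp
qed

lemma bounded_linear_scaleC: "bounded_linear (\<lambda>x. a *\<^sub>C (x::'a::chilbert_space))"
  by (rule bounded_linear_intro[of _ "cmod a"])
    (simp_all add: scaleC_add_right scaleR_scaleC scaleC_scaleC mult.commute norm_scaleC)


section \<open>The algebra of bounded complex-linear operators\<close>

typedef (overloaded) 'a bop =
  "{T :: 'a::chilbert_space \<Rightarrow>\<^sub>L 'a. \<forall>a x. blinfun_apply T (a *\<^sub>C x) = a *\<^sub>C blinfun_apply T x}"
  morphisms blinfun_of_bop Bop
  by (rule exI[of _ 0]) (simp add: complex_vector.scale_zero_right)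

setup_lifting type_definition_bop

text \<open>\<open>T \<cdot> \<xi>\<close> is the value of the operator \<open>T\<close> at the vector \<open>\<xi>\<close>.\<close>

lift_definition bop_apply :: "'a::chilbert_space bop \<Rightarrow> 'a \<Rightarrow> 'a" (infixr "\<cdot>" 80)
  is blinfun_apply .

text \<open>The norm is the operator norm and the multiplication is the composition.\<close>

instantiation bop :: (chilbert_space) "{complex_vector, real_normed_algebra}"
begin

lift_definition zero_bop :: "'a bop" is 0
  by (simp add: complex_vector.scale_zero_right)

lift_definition plus_bop :: "'a bop \<Rightarrow> 'a bop \<Rightarrow> 'a bop" is "(+)"
  by (simp add: blinfun.add_left scaleC_add_right)

lift_definition minus_bop :: "'a bop \<Rightarrow> 'a bop \<Rightarrow> 'a bop" is "(-)"
  by (simp add: blinfun.diff_left complex_vector.scale_right_diff_distrib)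

lift_definition uminus_bop :: "'a bop \<Rightarrow> 'a bop" is uminus
  by (simp add: blinfun.minus_left complex_vector.scale_minus_right)

lift_definition times_bop :: "'a bop \<Rightarrow> 'a bop \<Rightarrow> 'a bop" is "(o\<^sub>L)"
  by simp

lift_definition scaleC_bop :: "complex \<Rightarrow> 'a bop \<Rightarrow> 'a bop"
  is "\<lambda>a T. Blinfun (\<lambda>x. a *\<^sub>C x) o\<^sub>L T"
  by (simp add: bounded_linear_Blinfun_apply bounded_linear_scaleC scaleC_scaleC mult.commute)

lift_definition scaleR_bop :: "real \<Rightarrow> 'a bop \<Rightarrow> 'a bop" is scaleR
  by (simp add: blinfun.scaleR_left scaleR_scaleC scaleC_scaleC mult.commute)

lift_definition norm_bop :: "'a bop \<Rightarrow> real" is norm .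

definition dist_bop :: "'a bop \<Rightarrow> 'a bop \<Rightarrow> real"
  where "dist_bop S T = norm (S - T)"

definition sgn_bop :: "'a bop \<Rightarrow> 'a bop"
  where "sgn_bop T = inverse (norm T) *\<^sub>R T"

definition uniformity_bop :: "('a bop \<times> 'a bop) filter"
  where "uniformity_bop = (INF e\<in>{0 <..}. principal {(S, T). dist S T < e})"

definition open_bop :: "'a bop set \<Rightarrow> bool"
  where "open_bop U = (\<forall>S\<in>U. \<forall>\<^sub>F (S', T) in uniformity. S' = S \<longrightarrow> T \<in> U)"

instance
proof
  fix a b :: complex and r s :: real and R S T :: "'a bop"
  show "R + S + T = R + (S + T)" "S + T = T + S" "0 + T = T" "- T + T = 0" "S - T = S + - T"
    by (transfer, simp)+
  show "r *\<^sub>R (S + T) = r *\<^sub>R S + r *\<^sub>R T" "(r + s) *\<^sub>R T = r *\<^sub>R T + s *\<^sub>R T"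
    "r *\<^sub>R s *\<^sub>R T = (r * s) *\<^sub>R T" "1 *\<^sub>R T = T"
    by (transfer, simp add: scaleR_add_right scaleR_add_left)+
  show "a *\<^sub>C (S + T) = a *\<^sub>C S + a *\<^sub>C T" "(a + b) *\<^sub>C T = a *\<^sub>C T + b *\<^sub>C T"
    "a *\<^sub>C b *\<^sub>C T = (a * b) *\<^sub>C T" "1 *\<^sub>C T = T" "r *\<^sub>R T = complex_of_real r *\<^sub>C T"
    by (transfer, rule blinfun_eqI,
        simp add: bounded_linear_Blinfun_apply bounded_linear_scaleC blinfun.add_left
          blinfun.scaleR_left scaleC_add_right scaleC_add_left scaleC_scaleC scaleC_one
          scaleR_scaleC)+
  show "(R * S) * T = R * (S * T)"
    by (transfer, rule blinfun_eqI, simp)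
  show "(R + S) * T = R * T + S * T" "R * (S + T) = R * S + R * T"
    "(r *\<^sub>R S) * T = r *\<^sub>R (S * T)" "S * (r *\<^sub>R T) = r *\<^sub>R (S * T)"
    by (transfer, rule blinfun_eqI,
        simp add: blinfun.add_left blinfun.add_right blinfun.scaleR_left blinfun.scaleR_right)+
  show "dist S T = norm (S - T)" by (rule dist_bop_def)
  show "sgn T = inverse (norm T) *\<^sub>R T" by (rule sgn_bop_def)
  show "uniformity = (INF e\<in>{0 <..}. principal {(S, T :: 'a bop). dist S T < e})"
    by (rule uniformity_bop_def)
  show "open U = (\<forall>S\<in>U. \<forall>\<^sub>F (S', T) in uniformity. S' = S \<longrightarrow> T \<in> U)" for U :: "'a bop set"
    by (rule open_bop_def)
  show "norm T = 0 \<longleftrightarrow> T = 0" by (transfer, simp)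
  show "norm (S + T) \<le> norm S + norm T" by (transfer, rule norm_triangle_ineq)
  show "norm (r *\<^sub>R T) = \<bar>r\<bar> * norm T" by (transfer, simp)
  show "norm (S * T) \<le> norm S * norm T" by (transfer, rule norm_blinfun_compose)
qed

end

text \<open>
  The weak* topology of the operators as the dual of the trace class operators. The trace class
  operators are the norm convergent sums of the rank one operators given by \<open>\<xi> n\<close> and \<open>\<eta> n\<close>
  with both sequences square summable, and the corresponding functionals on the operators
  are the ones below.
\<close>

definition trace_functionals :: "('a::chilbert_space bop \<Rightarrow> complex) set" where
  "trace_functionals =
     {(\<lambda>T. \<Sum>n. cinner (T \<cdot> \<xi> n) (\<eta> n)) | \<xi> \<eta> :: nat \<Rightarrow> 'a.
        summable (\<lambda>n. (norm (\<xi> n))\<^sup>2) \<and> summable (\<lambda>n. (norm (\<eta> n))\<^sup>2)}"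

definition weak_star :: "'a::chilbert_space bop topology" where
  "weak_star = topology_generated_by {\<omega> -` S | \<omega> S. \<omega> \<in> trace_functionals \<and> open S}"


section \<open>Masas and masa-bimodules\<close>

definition adjoint_pair :: "'a::chilbert_space bop \<Rightarrow> 'a bop \<Rightarrow> bool" where
  "adjoint_pair T S \<longleftrightarrow> (\<forall>x y. cinner (T \<cdot> x) y = cinner x (S \<cdot> y))"

definition abelian_selfadjoint_algebra :: "'a::chilbert_space bop set \<Rightarrow> bool" where
  "abelian_selfadjoint_algebra \<D> \<longleftrightarrow>
     csubspace \<D> \<and> (\<forall>A\<in>\<D>. \<forall>B\<in>\<D>. A * B \<in> \<D> \<and> A * B = B * A) \<and>
     (\<forall>A\<in>\<D>. \<exists>B\<in>\<D>. adjoint_pair A B)"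

definition masa :: "'a::chilbert_space bop set \<Rightarrow> bool" where
  "masa \<D> \<longleftrightarrow> abelian_selfadjoint_algebra \<D> \<and>
     (\<forall>\<E>. abelian_selfadjoint_algebra \<E> \<and> \<D> \<subseteq> \<E> \<longrightarrow> \<E> = \<D>)"

definition weak_star_closed_subspace :: "'a::chilbert_space bop set \<Rightarrow> bool" where
  "weak_star_closed_subspace \<X> \<longleftrightarrow> csubspace \<X> \<and> closedin weak_star \<X>"

definition masa_bimodule :: "'a::chilbert_space bop set \<Rightarrow> 'a bop set \<Rightarrow> bool" where
  "masa_bimodule \<D> \<X> \<longleftrightarrow> weak_star_closed_subspace \<X> \<and>
     (\<forall>A\<in>\<D>. \<forall>X\<in>\<X>. \<forall>B\<in>\<D>. A * X * B \<in> \<X>)"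


section \<open>Hyperreflexivity\<close>

text \<open>
  The distance from \<open>T\<close> to \<open>\<X>\<close> in operator norm is \<^term>\<open>infdist T \<X>\<close>. Adding \<open>0\<close> to the
  nonnegative numbers whose supremum is taken matters only for the zero space, which has no unit
  vectors.
\<close>

definition alpha :: "'a::chilbert_space bop \<Rightarrow> 'a bop set \<Rightarrow> real" where
  "alpha T \<X> = Sup (insert 0 {infdist (T \<cdot> \<xi>) ((\<lambda>X. X \<cdot> \<xi>) ` \<X>) | \<xi>. norm \<xi> = 1})"

definition hyperreflexive :: "'a::chilbert_space bop set \<Rightarrow> bool" where
  "hyperreflexive \<X> \<longleftrightarrow> weak_star_closed_subspace \<X> \<and>
     (\<exists>k>0. \<forall>T. infdist T \<X> \<le> k * alpha T \<X>)"

definition hyperreflexivity_constant :: "'a::chilbert_space bop set \<Rightarrow> real" where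
  "hyperreflexivity_constant \<X> = Inf {k. k > 0 \<and> (\<forall>T. infdist T \<X> \<le> k * alpha T \<X>)}"


section \<open>Schur idempotents and approximate H-injectivity\<close>

definition schur_idempotent ::
    "'a::chilbert_space bop set \<Rightarrow> ('a bop \<Rightarrow> 'a bop) \<Rightarrow> bool" where
  "schur_idempotent \<D> \<Phi> \<longleftrightarrow> clinear \<Phi> \<and> continuous_map weak_star weak_star \<Phi> \<and>
     (\<forall>A\<in>\<D>. \<forall>T. \<forall>B\<in>\<D>. \<Phi> (A * T * B) = A * \<Phi> T * B) \<and> \<Phi> \<circ> \<Phi> = \<Phi>"

definition schur_H :: "'a::chilbert_space bop set \<Rightarrow> ('a bop \<Rightarrow> 'a bop) set" where
  "schur_H \<D> = {\<Phi>. schur_idempotent \<D> \<Phi> \<and>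
     (\<exists>l>0. \<forall>T. norm (T - \<Phi> T) \<le> l * alpha T (range \<Phi>))}"

definition lambda_const :: "('a::chilbert_space bop \<Rightarrow> 'a bop) \<Rightarrow> real" where
  "lambda_const \<Phi> = Inf {l. l > 0 \<and> (\<forall>T. norm (T - \<Phi> T) \<le> l * alpha T (range \<Phi>))}"

text \<open>
  The order \<open>\<Phi> \<le> \<Psi>\<close> of Schur idempotents is \<open>\<Phi> \<circ> \<Psi> = \<Phi>\<close>. Boundedness of each \<open>\<Phi> n\<close>, automatic
  for weak* continuous maps, is required so that \<^const>\<open>onorm\<close> is meaningful.
\<close>

definition decreases_to ::
    "'a::chilbert_space bop set \<Rightarrow> (nat \<Rightarrow> 'a bop \<Rightarrow> 'a bop) \<Rightarrow> 'a bop set \<Rightarrow> bool" where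
  "decreases_to \<D> \<Phi> \<V> \<longleftrightarrow>
     (\<forall>n. schur_idempotent \<D> (\<Phi> n)) \<and>
     (\<forall>n. bounded_linear (\<Phi> n)) \<and> bdd_above (range (\<lambda>n. onorm (\<Phi> n))) \<and>
     (\<forall>n. \<Phi> (Suc n) \<circ> \<Phi> n = \<Phi> (Suc n)) \<and> \<V> = (\<Inter>n. range (\<Phi> n))"

definition H_approximation ::
    "'a::chilbert_space bop set \<Rightarrow> 'a bop set \<Rightarrow> (nat \<Rightarrow> 'a bop \<Rightarrow> 'a bop) \<Rightarrow> bool" where
  "H_approximation \<D> \<V> \<Phi> \<longleftrightarrow> decreases_to \<D> \<Phi> \<V> \<and> (\<forall>n. \<Phi> n \<in> schur_H \<D>) \<and>
     bdd_above (range (\<lambda>n. lambda_const (\<Phi> n)))"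

definition approx_H_injective :: "'a::chilbert_space bop set \<Rightarrow> 'a bop set \<Rightarrow> bool" where
  "approx_H_injective \<D> \<V> \<longleftrightarrow> masa_bimodule \<D> \<V> \<and> (\<exists>\<Phi>. H_approximation \<D> \<V> \<Phi>)"

definition lambda_H :: "'a::chilbert_space bop set \<Rightarrow> 'a bop set \<Rightarrow> real" where
  "lambda_H \<D> \<V> = Inf {(SUP n. lambda_const (\<Phi> n)) | \<Phi>. H_approximation \<D> \<V> \<Phi>}"

end

theory Submission
  imports Defs "HOL-Complex_Analysis.Great_Picard"
begin

text \<open>
  A Schur idempotent maps every hyperreflexive masa-bimodule into itself. Hence, if \<open>X \<in> \<U>\<close> is
  nearly optimal for the distance from \<open>T\<close> to \<open>\<U>\<close>, then \<open>\<Phi> X\<close> lies in \<open>\<U> \<inter> range \<Phi>\<close>, and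
  \<open>norm (T - \<Phi> X)\<close> is at most \<open>norm (T - X) + norm (X - \<Phi> X)\<close>, where the second summand is at most
  \<open>\<lambda> * (alpha T (range \<Phi>) + norm (T - X))\<close>. Since \<open>alpha T\<close> is antitone, this is the bound with
  \<open>\<U> \<inter> range \<Phi>\<close> in place of \<open>\<U> \<inter> \<V>\<close>. For a sequence \<open>\<Phi> n\<close> decreasing to \<open>\<V>\<close>, a weak*
  cluster point of the approximants so obtained lies in \<open>\<U> \<inter> \<V>\<close>, as the ranges decrease, and the
  norm is weak* lower semicontinuous.
\<close>

section \<open>Complex inner products\<close>

lemma cinner_add_right: "cinner x (y + z) = cinner x y + cinner x (z::'a::chilbert_space)"
  by (metis cinner_add_left cinner_commute complex_cnj_add)

lemma cinner_scaleC_right: "cinner x (a *\<^sub>C y) = cnj a * cinner x (y::'a::chilbert_space)"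
  by (metis cinner_commute cinner_scaleC_left complex_cnj_mult)

lemma cinner_zero_left [simp]: "cinner 0 (y::'a::chilbert_space) = 0"
  using cinner_add_left[of 0 0 y] by simp

lemma cinner_zero_right [simp]: "cinner (x::'a::chilbert_space) 0 = 0"
  using cinner_add_right[of x 0 0] by simp

lemma cinner_diff_left: "cinner (x - y) z = cinner x z - cinner y (z::'a::chilbert_space)"
  using cinner_add_left[of "x - y" y z] by simp

lemma cinner_diff_right: "cinner x (y - z) = cinner x y - cinner x (z::'a::chilbert_space)"
  using cinner_add_right[of x "y - z" z] by simp

lemma cinner_self: "cinner x x = complex_of_real ((norm (x::'a::chilbert_space))\<^sup>2)"
proof -
  have "Im (cinner x x) = 0"
    using arg_cong[OF cinner_commute[of x x], of Im] by simp
  then show ?thesis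
    by (simp add: complex_eq_iff power2_norm_eq_inner inner_eq_Re_cinner)
qed

text \<open>A unimodular factor \<open>a\<close> turns \<open>cinner x y\<close> into its modulus,
  which reduces the bound to Cauchy-Schwarz for the real inner product.\<close>

lemma norm_cinner_le: "cmod (cinner x y) \<le> norm x * norm (y::'a::chilbert_space)"
proof (cases "cinner x y = 0")
  case False
  define a where "a = cnj (sgn (cinner x y))"
  have a: "cmod a = 1" using False by (simp add: a_def norm_sgn)
  have "a * cinner x y = complex_of_real (cmod (cinner x y))"
    using False
    by (simp add: a_def sgn_eq complex_norm_square[symmetric] power2_eq_square mult.commute)
  then have "inner (a *\<^sub>C x) y = cmod (cinner x y)"
    by (simp add: inner_eq_Re_cinner cinner_scaleC_left)
  moreover have "inner (a *\<^sub>C x) y \<le> norm (a *\<^sub>C x) * norm y"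
    by (rule norm_cauchy_schwarz)
  ultimately show ?thesis using a by (simp add: norm_scaleC)
qed simp

lemma cinner_right_eqI:
  assumes "\<And>y. cinner x y = cinner x' (y::'a::chilbert_space)"
  shows "x = x'"
proof -
  have "cinner (x - x') (x - x') = 0"
    by (simp add: assms cinner_diff_left)
  then show ?thesis by (simp add: cinner_self)
qed

lemma norm_le_cinnerI:
  assumes "\<And>y. cmod (cinner x y) \<le> b * norm (y::'a::chilbert_space)" "b \<ge> 0"
  shows "norm x \<le> b"
proof (cases "x = 0")
  case False
  have "norm x * norm x \<le> b * norm x"
    using assms(1)[of x] by (simp add: cinner_self power2_eq_square norm_mult)
  then show ?thesis using False by simp
qed (use assms in simp)

text \<open>Sums and multiples of limits are limits of sums and multiples. The lemma serves for
  \<open>f\<close> the evaluation at a vector \<open>\<xi>\<close>, where it shows that the closures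
  of \<open>\<U> \<xi>\<close> and \<open>\<D> \<xi>\<close> are complex subspaces, so that they
  have orthogonal projections.\<close>

lemma csubspace_closure_image:
  assumes "csubspace (X :: 'b::complex_vector set)"
    and f: "\<And>x y. f (x + y) = f x + f y" "\<And>a x. f (a *\<^sub>C x) = a *\<^sub>C (f x :: 'a::chilbert_space)"
  shows "csubspace (closure (f ` X))"
proof -
  have X: "0 \<in> X" "\<And>x y. x \<in> X \<Longrightarrow> y \<in> X \<Longrightarrow> x + y \<in> X" "\<And>a x. x \<in> X \<Longrightarrow> a *\<^sub>C x \<in> X"
    using assms(1) by (auto simp: complex_vector.subspace_def)
  have 0: "f 0 = 0" using f(1)[of 0 0] by simp
  show ?thesis
    unfolding complex_vector.subspace_def
  proof (intro conjI ballI allI)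
    show "0 \<in> closure (f ` X)"
      using X(1) 0 closure_subset[of "f ` X"] by (metis image_eqI subsetD)
  next
    fix x y assume "x \<in> closure (f ` X)" "y \<in> closure (f ` X)"
    then obtain u v where u: "\<And>n. u n \<in> f ` X" "u \<longlonglongrightarrow> x" and v: "\<And>n. v n \<in> f ` X" "v \<longlonglongrightarrow> y"
      by (auto simp: closure_sequential)
    have "u n + v n \<in> f ` X" for n
      using u(1)[of n] v(1)[of n] X(2) by (auto simp: image_iff) (metis f(1))
    moreover have "(\<lambda>n. u n + v n) \<longlonglongrightarrow> x + y" using u v by (intro tendsto_add)
    ultimately show "x + y \<in> closure (f ` X)"
      by (auto simp: closure_sequential intro!: exI[of _ "\<lambda>n. u n + v n"])
  next
    fix x and a assume "x \<in> closure (f ` X)"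
    then obtain u where u: "\<And>n. u n \<in> f ` X" "u \<longlonglongrightarrow> x"
      by (auto simp: closure_sequential)
    have "a *\<^sub>C u n \<in> f ` X" for n
      using u(1)[of n] X(3) by (auto simp: image_iff) (metis f(2))
    moreover have "(\<lambda>n. a *\<^sub>C u n) \<longlonglongrightarrow> a *\<^sub>C x"
      using u(2) by (rule bounded_linear.tendsto[OF bounded_linear_scaleC])
    ultimately show "a *\<^sub>C x \<in> closure (f ` X)"
      by (auto simp: closure_sequential intro!: exI[of _ "\<lambda>n. a *\<^sub>C u n"])
  qed
qed

lemma csubspace_imp_subspace: "csubspace (M::'a::complex_vector set) \<Longrightarrow> subspace M"
  by (auto simp: complex_vector.subspace_def subspace_def scaleR_scaleC)

section \<open>Operators\<close>

lemma bop_add: "T \<cdot> (x + y) = T \<cdot> x + T \<cdot> y"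
  by transfer (rule blinfun.add_right)

lemma bop_diff: "T \<cdot> (x - y) = T \<cdot> x - T \<cdot> y"
  by transfer (rule blinfun.diff_right)

lemma bop_scaleC: "T \<cdot> (a *\<^sub>C x) = a *\<^sub>C (T \<cdot> x)"
  by transfer blast

lemma bop_plus_apply: "(S + T) \<cdot> x = S \<cdot> x + T \<cdot> x"
  by transfer (rule blinfun.add_left)

lemma bop_minus_apply: "(S - T) \<cdot> x = S \<cdot> x - T \<cdot> x"
  by transfer (rule blinfun.diff_left)

lemma bop_times_apply: "(S * T) \<cdot> x = S \<cdot> T \<cdot> x"
  by transfer simp

lemma bop_scaleC_apply: "(a *\<^sub>C T) \<cdot> x = a *\<^sub>C (T \<cdot> x)"
  by transfer (simp add: bounded_linear_Blinfun_apply bounded_linear_scaleC)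

lemma bop_zero_apply [simp]: "0 \<cdot> x = 0"
  by transfer simp

lemma bop_eqI: "(\<And>x. S \<cdot> x = T \<cdot> x) \<Longrightarrow> S = T"
  by transfer (rule blinfun_eqI)

lemma norm_bop_apply_le: "norm (T \<cdot> x) \<le> norm T * norm x"
  by transfer (rule norm_blinfun)

lemma norm_bop_leI: "0 \<le> b \<Longrightarrow> (\<And>x. norm (T \<cdot> x) \<le> b * norm x) \<Longrightarrow> norm T \<le> b"
  by transfer (rule norm_blinfun_bound)

lemma bounded_linear_bop: "bounded_linear (\<lambda>x. T \<cdot> x)"
  by transfer (rule blinfun.bounded_linear_right)

section \<open>Riesz representation and orthogonal projections\<close>

text \<open>For \<open>f = inner y\<close> the vector \<open>z\<close> is the projection of \<open>y\<close> to \<open>M\<close>. In general it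
  minimises \<open>norm x ^ 2 - 2 * f x\<close> over \<open>M\<close>.\<close>

lemma riesz_subspace:
  fixes f :: "'a::{real_inner, complete_space} \<Rightarrow> real"
  assumes "bounded_linear f" "subspace M" "closed M"
  shows "\<exists>z\<in>M. \<forall>x\<in>M. inner z x = f x"
proof -
  interpret f: bounded_linear f by fact
  define q where "q x = (norm x)\<^sup>2 - 2 * f x" for x
  obtain K where K: "\<And>x. norm (f x) \<le> norm x * K" using f.bounded by blast
  \<comment> \<open>Completing the square: \<open>q x\<close> is at least
    \<open>(norm x - K) ^ 2 - K ^ 2\<close>.\<close>
  have lower: "- K\<^sup>2 \<le> q x" for x
  proof -
    have "f x \<le> norm x * K" using K[of x] by simp
    moreover have "0 \<le> (norm x - K)\<^sup>2" by simp
    ultimately show ?thesis by (simp add: q_def power2_diff)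
  qed
  define m where "m = Inf (q ` M)"
  have 0: "0 \<in> M" using assms(2) by (rule subspace_0)
  have bdd: "bdd_below (q ` M)" using lower by (auto simp: bdd_below_def)
  have m: "m \<le> q x" if "x \<in> M" for x
    unfolding m_def using that bdd by (intro cInf_lower) auto
  have "\<exists>x\<in>M. q x < m + inverse (Suc n)" for n
  proof -
    have "Inf (q ` M) < m + inverse (Suc n)" by (simp add: m_def)
    from cInf_lessD[OF _ this] 0 show ?thesis by blast
  qed
  then obtain X where X: "\<And>n. X n \<in> M" "\<And>n. q (X n) < m + inverse (Suc n)" by metis
  \<comment> \<open>This is the parallelogram law; the linear terms of \<open>q\<close> cancel. As
    the midpoint of two points of \<open>M\<close> has \<open>q\<close> at least \<open>m\<close>,
    every minimising sequence is Cauchy.\<close>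
  have para: "(norm (x - y))\<^sup>2 = 2 * q x + 2 * q y - 4 * q ((1/2) *\<^sub>R (x + y))" for x y
    unfolding q_def f.scaleR f.add power2_norm_eq_inner
    by (simp add: inner_simps algebra_simps inner_commute)
  have cauchy: "(norm (X i - X j))\<^sup>2 \<le> 2 * inverse (Suc i) + 2 * inverse (Suc j)" for i j
  proof -
    have "(1/2) *\<^sub>R (X i + X j) \<in> M"
      using assms(2) X(1) by (intro subspace_scale subspace_add)
    from m[OF this] show ?thesis using X(2)[of i] X(2)[of j] unfolding para by linarith
  qed
  have "Cauchy X"
  proof (rule metric_CauchyI)
    fix e :: real assume e: "0 < e"
    then obtain N where N: "inverse (Suc N) < e\<^sup>2 / 4"
      using reals_Archimedean[of "e\<^sup>2 / 4"] by auto
    show "\<exists>N. \<forall>i\<ge>N. \<forall>j\<ge>N. dist (X i) (X j) < e"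
    proof (intro exI allI impI)
      fix i j assume ij: "N \<le> i" "N \<le> j"
      have "inverse (real (Suc i)) \<le> inverse (Suc N)" "inverse (real (Suc j)) \<le> inverse (Suc N)"
        using ij by (auto intro!: le_imp_inverse_le)
      then have "(norm (X i - X j))\<^sup>2 < e\<^sup>2" using cauchy[of i j] N by linarith
      then show "dist (X i) (X j) < e"
        using e by (auto simp: dist_norm intro: power_less_imp_less_base)
    qed
  qed
  then obtain z where z: "X \<longlonglongrightarrow> z" using Cauchy_convergent by (auto simp: convergent_def)
  have zM: "z \<in> M" using closed_sequentially[OF assms(3) X(1) z] .
  have "(\<lambda>n. q (X n)) \<longlonglongrightarrow> q z"
    unfolding q_def using z f.tendsto[OF z] by (intro tendsto_intros)
  moreover have "(\<lambda>n. m + inverse (real (Suc n))) \<longlonglongrightarrow> m + 0"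
    by (intro tendsto_intros LIMSEQ_inverse_real_of_nat)
  ultimately have "q z \<le> m"
    using LIMSEQ_le[of "\<lambda>n. q (X n)" "q z" "\<lambda>n. m + inverse (real (Suc n))" m] X(2)
    by (auto intro: less_imp_le)
  then have min: "q z \<le> q x" if "x \<in> M" for x using m[OF that] by simp
  have "inner z x = f x" if x: "x \<in> M" for x
  proof -
    define c where "c = f x - inner z x"
    define N where "N = (norm x)\<^sup>2"
    \<comment> \<open>Moving the minimiser by \<open>t\<close> along \<open>x\<close> changes
      \<open>q\<close> by \<open>t ^ 2 * N - 2 * t * c\<close>. The best choice would be
      \<open>c / N\<close>; the denominator \<open>N + 1\<close> also covers \<open>x = 0\<close>
      and still makes the change negative unless \<open>c = 0\<close>.\<close>
    define t where "t = c / (N + 1)"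
    have N: "N \<ge> 0" by (simp add: N_def)
    have "z + t *\<^sub>R x \<in> M" using assms(2) zM x by (intro subspace_add subspace_scale)
    from min[OF this] have "0 \<le> t\<^sup>2 * N - 2 * t * c"
      unfolding q_def f.scaleR f.add N_def c_def power2_norm_eq_inner
      by (simp add: inner_simps algebra_simps inner_commute power2_eq_square)
    also have "\<dots> = - (t\<^sup>2 * (N + 2))"
    proof -
      have "c = t * (N + 1)" using N by (simp add: t_def)
      then show ?thesis by (simp add: power2_eq_square algebra_simps)
    qed
    finally have "t\<^sup>2 * (N + 2) \<le> 0" by simp
    then have "t = 0" using N by (simp add: mult_le_0_iff)
    then have "c = 0" using N by (simp add: t_def)
    then show ?thesis by (simp add: c_def)
  qed
  then show ?thesis using zM by blast
qed

lemma bop_exists: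
  fixes f :: "'a::chilbert_space \<Rightarrow> 'a"
  assumes "\<And>x y. f (x + y) = f x + f y" "\<And>a x. f (a *\<^sub>C x) = a *\<^sub>C f x"
    and "\<And>x. norm (f x) \<le> K * norm x"
  obtains T where "\<And>x. T \<cdot> x = f x"
proof -
  have f: "bounded_linear f"
    by (rule bounded_linear_intro[of _ K]) (simp_all add: assms scaleR_scaleC mult.commute)
  have "bop_apply (Bop (Blinfun f)) x = f x" for x
    unfolding bop_apply.rep_eq
    by (subst Bop_inverse) (simp_all add: bounded_linear_Blinfun_apply f assms)
  then show ?thesis using that by blast
qed

text \<open>Riesz representation of \<open>b x\<close> for each fixed \<open>x\<close> gives the
  value of the operator at \<open>x\<close>. Linearity and boundedness are read off from
  \<open>b\<close>, as a vector is determined by its inner products.\<close>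

lemma bounded_sesquilinear_bop:
  fixes b :: "'a::chilbert_space \<Rightarrow> 'a \<Rightarrow> complex"
  assumes add_left: "\<And>x x' y. b (x + x') y = b x y + b x' y"
    and scale_left: "\<And>a x y. b (a *\<^sub>C x) y = a * b x y"
    and add_right: "\<And>x y y'. b x (y + y') = b x y + b x y'"
    and scale_right: "\<And>a x y. b x (a *\<^sub>C y) = cnj a * b x y"
    and bound: "\<And>x y. cmod (b x y) \<le> C * norm x * norm y" and "C \<ge> 0"
  obtains T where "\<And>x y. cinner (T \<cdot> x) y = b x y"
proof -
  have "\<exists>z. \<forall>y. cinner z y = b x y" for x
  proof -
    have "bounded_linear (\<lambda>y. Re (b x y))"
    proof (rule bounded_linear_intro[of _ "C * norm x"])
      fix r y z
      show "Re (b x (y + z)) = Re (b x y) + Re (b x z)" by (simp add: add_right)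
      show "Re (b x (r *\<^sub>R y)) = r *\<^sub>R Re (b x y)"
        unfolding scaleR_scaleC[of r y] scale_right by simp
      have "norm (Re (b x y)) \<le> C * norm x * norm y"
        using abs_Re_le_cmod[of "b x y"] bound[of x y] by simp
      then show "norm (Re (b x y)) \<le> norm y * (C * norm x)"
        by (simp only: mult.commute)
    qed
    from riesz_subspace[OF this subspace_UNIV closed_UNIV]
    obtain z where "\<forall>y. inner z y = Re (b x y)" by auto
    then have z: "Re (cinner z y) = Re (b x y)" for y by (simp add: inner_eq_Re_cinner)
    \<comment> \<open>Replacing \<open>y\<close> by \<open>\<i> *\<^sub>C y\<close> multiplies both
      sides by \<open>- \<i>\<close>, so that equal real parts there are equal imaginary parts at
      \<open>y\<close>.\<close>
    have "Im (cinner z y) = Im (b x y)" for y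
      using z[of "\<i> *\<^sub>C y"] by (simp add: cinner_scaleC_right scale_right)
    with z have "cinner z y = b x y" for y by (intro complex_eqI) auto
    then show ?thesis by blast
  qed
  then obtain f where f: "\<And>x y. cinner (f x) y = b x y" by metis
  have "f (x + y) = f x + f y" for x y
    by (rule cinner_right_eqI) (simp add: f cinner_add_left add_left)
  moreover have "f (a *\<^sub>C x) = a *\<^sub>C f x" for a x
    by (rule cinner_right_eqI) (simp add: f cinner_scaleC_left scale_left)
  moreover have "norm (f x) \<le> C * norm x" for x
    by (rule norm_le_cinnerI) (use bound \<open>C \<ge> 0\<close> f in auto)
  ultimately obtain T where "\<And>x. T \<cdot> x = f x" using bop_exists[of f C] by blast
  with f show ?thesis by (intro that[of T]) simp
qed

text \<open>The projection of \<open>x\<close> represents \<open>inner x\<close> on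
  \<open>M\<close>. This is orthogonality for the real inner product only, and it becomes complex
  orthogonality because \<open>M\<close> is closed under multiplication by
  \<open>\<i>\<close>.\<close>

lemma orthogonal_projection_exists:
  fixes M :: "'a::chilbert_space set"
  assumes "csubspace M" "closed M"
  obtains P where "\<And>x. P \<cdot> x \<in> M" "\<And>x. x \<in> M \<Longrightarrow> P \<cdot> x = x"
    "\<And>x m. m \<in> M \<Longrightarrow> cinner (x - P \<cdot> x) m = 0"
proof -
  have M: "x + y \<in> M" "a *\<^sub>C x \<in> M" "x - y \<in> M" if "x \<in> M" "y \<in> M" for x y a
    using assms(1) that
    by (auto simp: complex_vector.subspace_add complex_vector.subspace_scale
        complex_vector.subspace_diff)
  have "\<exists>z\<in>M. \<forall>m\<in>M. cinner (x - z) m = 0" for x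
  proof -
    obtain z where z: "z \<in> M" "\<And>m. m \<in> M \<Longrightarrow> inner z m = inner x m"
      using riesz_subspace[OF bounded_linear_inner_right[of x] csubspace_imp_subspace[OF assms(1)]
          assms(2)] by blast
    then have re: "Re (cinner (x - z) m) = 0" if "m \<in> M" for m
      using that by (simp add: cinner_diff_left inner_eq_Re_cinner)
    have "Im (cinner (x - z) m) = 0" if "m \<in> M" for m
      using re[OF M(2)[OF that that, of \<i>]] by (simp add: cinner_scaleC_right)
    then show ?thesis using re z(1) by (auto simp: complex_eq_iff)
  qed
  then obtain p where p: "\<And>x. p x \<in> M" "\<And>x m. m \<in> M \<Longrightarrow> cinner (x - p x) m = 0"
    by metis
  \<comment> \<open>Uniqueness of the point of \<open>M\<close> with orthogonal remainder yields
    additivity and homogeneity of \<open>p\<close> below.\<close>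
  have unique: "p x = z" if "z \<in> M" "\<And>m. m \<in> M \<Longrightarrow> cinner (x - z) m = 0" for x z
  proof -
    have m: "p x - z \<in> M" using p(1) that(1) by (rule M(3))
    have "cinner (p x - z) (p x - z) = cinner (x - z) (p x - z) - cinner (x - p x) (p x - z)"
      by (simp add: cinner_diff_left)
    also have "\<dots> = 0" using that(2)[OF m] p(2)[OF m] by simp
    finally show ?thesis by (simp add: cinner_self)
  qed
  have "p (x + y) = p x + p y" for x y
  proof (rule unique)
    fix m assume "m \<in> M"
    then have "cinner (x - p x) m + cinner (y - p y) m = 0" by (simp add: p(2))
    then show "cinner (x + y - (p x + p y)) m = 0"
      by (simp add: cinner_add_left[symmetric] algebra_simps)
  qed (use M p in auto)
  moreover have "p (a *\<^sub>C x) = a *\<^sub>C p x" for a x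
  proof (rule unique)
    fix m assume "m \<in> M"
    then have "a * cinner (x - p x) m = 0" by (simp add: p(2))
    then show "cinner (a *\<^sub>C x - a *\<^sub>C p x) m = 0"
      by (simp add: cinner_diff_left cinner_scaleC_left right_diff_distrib)
  qed (use M(2)[OF p(1) p(1)] in auto)
  moreover have "norm (p x) \<le> 1 * norm x" for x
  proof -
    have "inner x (p x) = (norm (p x))\<^sup>2"
      using p(2)[OF p(1), of x x]
      by (simp add: cinner_diff_left inner_eq_Re_cinner power2_norm_eq_inner)
    then have "norm (p x) * norm (p x) \<le> norm x * norm (p x)"
      using norm_cauchy_schwarz[of x "p x"] by (simp add: power2_eq_square)
    then show ?thesis by (cases "p x = 0") auto
  qed
  ultimately obtain P where "\<And>x. P \<cdot> x = p x" using bop_exists[of p 1] by blast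
  then show ?thesis using that[of P] p unique by simp
qed

section \<open>Projections in a masa\<close>

lemma bop_scaleC_times: "(a *\<^sub>C S) * T = a *\<^sub>C (S * T :: 'a::chilbert_space bop)"
  by (rule bop_eqI) (simp add: bop_times_apply bop_scaleC_apply)

lemma bop_times_scaleC: "S * (a *\<^sub>C T) = a *\<^sub>C (S * T :: 'a::chilbert_space bop)"
  by (rule bop_eqI) (simp add: bop_times_apply bop_scaleC_apply bop_scaleC)

text \<open>The elements \<open>A + B P + c P\<close> with \<open>A\<close> and \<open>B\<close> in the masa form an abelian selfadjoint
  algebra. The term \<open>c P\<close> is needed as the masa is not known to be unital at this point.\<close>

lemma projection_in_masa:
  fixes \<D> :: "'a::chilbert_space bop set"
  assumes "masa \<D>" and P: "P * P = P" "adjoint_pair P P" and comm: "\<And>A. A \<in> \<D> \<Longrightarrow> A * P = P * A"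
  shows "P \<in> \<D>"
proof -
  define E where "E = {A + B * P + c *\<^sub>C P | A B c. A \<in> \<D> \<and> B \<in> \<D>}"
  have D: "abelian_selfadjoint_algebra \<D>"
    and max: "\<And>\<E>. abelian_selfadjoint_algebra \<E> \<Longrightarrow> \<D> \<subseteq> \<E> \<Longrightarrow> \<E> = \<D>"
    using assms(1) by (auto simp: masa_def)
  have sub: "csubspace \<D>" and mult: "\<And>A B. A \<in> \<D> \<Longrightarrow> B \<in> \<D> \<Longrightarrow> A * B \<in> \<D>"
    and ab: "\<And>A B. A \<in> \<D> \<Longrightarrow> B \<in> \<D> \<Longrightarrow> A * B = B * A"
    and adj: "\<And>A. A \<in> \<D> \<Longrightarrow> \<exists>B\<in>\<D>. adjoint_pair A B"
    using D by (auto simp: abelian_selfadjoint_algebra_def)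
  have 0: "0 \<in> \<D>" and add: "\<And>A B. A \<in> \<D> \<Longrightarrow> B \<in> \<D> \<Longrightarrow> A + B \<in> \<D>"
    and scale: "\<And>a A. A \<in> \<D> \<Longrightarrow> a *\<^sub>C A \<in> \<D>"
    using sub by (auto simp: complex_vector.subspace_def)
  have EI: "A + B * P + c *\<^sub>C P \<in> E" if "A \<in> \<D>" "B \<in> \<D>" for A B c
    using that unfolding E_def by blast
  \<comment> \<open>Rewrite rules that bring products of masa elements and \<open>P\<close> to a
    form with a single \<open>P\<close> at the right.\<close>
  have P': "A * (P * (B * P)) = A * (B * P)" "P * (B * P) = B * P" "P * B = B * P"
    "P * (P * B) = B * P" if "B \<in> \<D>" for A B
    using comm[OF that] P(1) by (metis mult.assoc)+
  have prod: "(A + B * P + c *\<^sub>C P) * (A' + B' * P + c' *\<^sub>C P) =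
      A * A' + (A * B' + B * A' + B * B' + c' *\<^sub>C A + c' *\<^sub>C B + c *\<^sub>C A' + c *\<^sub>C B') * P
        + (c * c') *\<^sub>C P"
    if "A \<in> \<D>" "B \<in> \<D>" "A' \<in> \<D>" "B' \<in> \<D>" for A B A' B' c c'
    using that
    by (simp add: distrib_left distrib_right bop_scaleC_times bop_times_scaleC mult.assoc P' P(1)
        scaleC_add_right scaleC_scaleC ac_simps)
  have "abelian_selfadjoint_algebra E"
    unfolding abelian_selfadjoint_algebra_def
  proof (intro conjI ballI)
    show "csubspace E"
      unfolding complex_vector.subspace_def
    proof (intro conjI ballI allI)
      show "0 \<in> E" using EI[OF 0 0, of 0] by simp
    next
      fix S T assume "S \<in> E" "T \<in> E"
      then obtain A B c A' B' c' where AB: "A \<in> \<D>" "B \<in> \<D>" "A' \<in> \<D>" "B' \<in> \<D>"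
        "S = A + B * P + c *\<^sub>C P" "T = A' + B' * P + c' *\<^sub>C P" unfolding E_def by blast
      have "S + T = (A + A') + (B + B') * P + (c + c') *\<^sub>C P"
        by (simp add: AB distrib_right scaleC_add_left)
      then show "S + T \<in> E"
        using EI[OF add[OF AB(1,3)] add[OF AB(2,4)], of "c + c'"] by (simp only:)
    next
      fix S a assume "S \<in> E"
      then obtain A B c where AB: "A \<in> \<D>" "B \<in> \<D>" "S = A + B * P + c *\<^sub>C P"
        unfolding E_def by blast
      have "a *\<^sub>C S = a *\<^sub>C A + (a *\<^sub>C B) * P + (a * c) *\<^sub>C P"
        by (simp add: AB scaleC_add_right bop_scaleC_times scaleC_scaleC)
      then show "a *\<^sub>C S \<in> E"
        using EI[OF scale[OF AB(1)] scale[OF AB(2)], of a a "a * c"] by (simp only:)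
    qed
  next
    fix S T assume "S \<in> E" "T \<in> E"
    then obtain A B c A' B' c' where AB: "A \<in> \<D>" "B \<in> \<D>" "A' \<in> \<D>" "B' \<in> \<D>"
      "S = A + B * P + c *\<^sub>C P" "T = A' + B' * P + c' *\<^sub>C P" unfolding E_def by blast
    show "S * T \<in> E" unfolding AB(5,6) prod[OF AB(1-4)]
      by (intro EI add scale mult AB)
    show "S * T = T * S" unfolding AB(5,6) prod[OF AB(1-4)] prod[OF AB(3,4,1,2)]
      by (simp add: ab[OF AB(1,3)] ab[OF AB(1,4)] ab[OF AB(2,3)] ab[OF AB(2,4)] mult.commute[of c]
          ac_simps)
  next
    fix S assume "S \<in> E"
    then obtain A B c where AB: "A \<in> \<D>" "B \<in> \<D>" "S = A + B * P + c *\<^sub>C P"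
      unfolding E_def by blast
    obtain A' B' where A': "A' \<in> \<D>" "adjoint_pair A A'" "B' \<in> \<D>" "adjoint_pair B B'"
      using adj AB by meson
    \<comment> \<open>The adjoint of \<open>B * P\<close> is \<open>P * B'\<close>, which equals
      \<open>B' * P\<close> as \<open>P\<close> commutes with the masa.\<close>
    have "adjoint_pair S (A' + B' * P + cnj c *\<^sub>C P)"
      unfolding adjoint_pair_def
    proof (intro allI)
      fix x y
      have "cinner (B \<cdot> P \<cdot> x) y = cinner x (P \<cdot> B' \<cdot> y)"
        using A'(4) P(2) by (simp add: adjoint_pair_def)
      also have "P \<cdot> B' \<cdot> y = B' \<cdot> P \<cdot> y"
        using comm[OF A'(3)] by (simp add: bop_times_apply[symmetric])
      finally show "cinner (S \<cdot> x) y = cinner x ((A' + B' * P + cnj c *\<^sub>C P) \<cdot> y)"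
        using A'(2) P(2)
        by (simp add: AB(3) bop_plus_apply bop_times_apply bop_scaleC_apply cinner_add_left
            cinner_add_right cinner_scaleC_left cinner_scaleC_right adjoint_pair_def)
    qed
    then show "\<exists>T\<in>E. adjoint_pair S T" using A' EI by blast
  qed
  moreover have "\<D> \<subseteq> E" using EI[OF _ 0, of _ 0] by auto
  ultimately have "E = \<D>" by (rule max)
  then show ?thesis using EI[OF 0 0, of 1] by (simp add: scaleC_one)
qed

text \<open>Since \<open>\<D>\<close> is selfadjoint, it leaves the orthogonal complement of
  \<open>M\<close> invariant as well. The projection to \<open>M\<close> therefore commutes with
  \<open>\<D>\<close> and lies in it by maximality.\<close>

lemma invariant_projection_in_masa:
  fixes \<D> :: "'a::chilbert_space bop set"
  assumes "masa \<D>" "csubspace M" "closed M" and inv: "\<And>A x. A \<in> \<D> \<Longrightarrow> x \<in> M \<Longrightarrow> A \<cdot> x \<in> M"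
  obtains P where "P \<in> \<D>" "\<And>x. P \<cdot> x \<in> M" "\<And>x. x \<in> M \<Longrightarrow> P \<cdot> x = x"
proof -
  obtain P where P: "\<And>x. P \<cdot> x \<in> M" "\<And>x. x \<in> M \<Longrightarrow> P \<cdot> x = x"
    "\<And>x m. m \<in> M \<Longrightarrow> cinner (x - P \<cdot> x) m = 0"
    using orthogonal_projection_exists[OF assms(2,3)] by metis
  have perp: "P \<cdot> x = 0" if "\<And>m. m \<in> M \<Longrightarrow> cinner x m = 0" for x
    using P(3)[OF P(1), of x x] that[OF P(1)] by (simp add: cinner_diff_left cinner_self)
  have "P * P = P" by (rule bop_eqI) (simp add: bop_times_apply P)
  moreover have "adjoint_pair P P"
    unfolding adjoint_pair_def
  proof (intro allI)
    fix x y
    have "cinner (P \<cdot> x) (y - P \<cdot> y) = 0"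
      using P(3)[OF P(1), of y x] cinner_commute[of "P \<cdot> x"] by simp
    then show "cinner (P \<cdot> x) y = cinner x (P \<cdot> y)"
      using P(3)[OF P(1), of x y] by (simp add: cinner_diff_left cinner_diff_right)
  qed
  moreover have "A * P = P * A" if A: "A \<in> \<D>" for A
  proof (rule bop_eqI)
    fix x
    obtain B where B: "B \<in> \<D>" "adjoint_pair A B"
      using assms(1) A by (auto simp: masa_def abelian_selfadjoint_algebra_def)
    \<comment> \<open>For \<open>m\<close> in \<open>M\<close> the inner product of
      \<open>A \<cdot> (x - P \<cdot> x)\<close> with \<open>m\<close> moves \<open>A\<close> over
      to \<open>B \<cdot> m\<close>, which is again in \<open>M\<close>.\<close>
    have "P \<cdot> A \<cdot> (x - P \<cdot> x) = 0"
      by (rule perp) (use B inv P(3) in \<open>simp add: adjoint_pair_def\<close>)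
    then show "(A * P) \<cdot> x = (P * A) \<cdot> x"
      using P(2)[OF inv[OF A P(1)]] by (simp add: bop_times_apply bop_diff)
  qed
  ultimately have "P \<in> \<D>" using projection_in_masa[OF assms(1)] by blast
  then show ?thesis using that P by blast
qed

section \<open>Sequences of operators in the weak* topology\<close>

lemma summable_mult_square:
  fixes a b :: "nat \<Rightarrow> real"
  assumes "summable (\<lambda>n. (a n)\<^sup>2)" "summable (\<lambda>n. (b n)\<^sup>2)"
  shows "summable (\<lambda>n. a n * b n)"
proof (rule summable_comparison_test)
  show "summable (\<lambda>n. (a n)\<^sup>2 + (b n)\<^sup>2)" using assms by (rule summable_add)
  have "\<bar>a n * b n\<bar> \<le> (a n)\<^sup>2 + (b n)\<^sup>2" for n
  proof -
    have "0 \<le> (\<bar>a n\<bar> - \<bar>b n\<bar>)\<^sup>2" by simp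
    then have "2 * (\<bar>a n\<bar> * \<bar>b n\<bar>) \<le> (a n)\<^sup>2 + (b n)\<^sup>2" by (simp add: power2_diff)
    moreover have "0 \<le> \<bar>a n\<bar> * \<bar>b n\<bar>" by simp
    ultimately show ?thesis unfolding abs_mult by linarith
  qed
  then show "\<exists>N. \<forall>n\<ge>N. norm (a n * b n) \<le> (a n)\<^sup>2 + (b n)\<^sup>2" by simp
qed

section \<open>Trace functionals and weak* convergence of bounded sequences\<close>

text \<open>Matrix coefficients are the functionals of rank one operators: both sequences are
  supported at the index \<open>0\<close>.\<close>

lemma cinner_mem_trace_functionals:
  "(\<lambda>T. cinner (T \<cdot> x) y) \<in> trace_functionals" for x y :: "'a::chilbert_space"
proof -
  define u where "u n = (if n = 0 then x else 0)" for n :: nat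
  define v where "v n = (if n = 0 then y else 0)" for n :: nat
  have "(\<Sum>n. cinner (T \<cdot> u n) (v n)) = cinner (T \<cdot> x) y" for T
  proof -
    have "(\<lambda>n. cinner (T \<cdot> u n) (v n)) sums (\<Sum>n\<in>{0}. cinner (T \<cdot> u n) (v n))"
      by (rule sums_finite) (auto simp: u_def v_def)
    then show ?thesis by (simp add: sums_unique[symmetric] u_def v_def)
  qed
  moreover have "summable (\<lambda>n. (norm (u n))\<^sup>2)" "summable (\<lambda>n. (norm (v n))\<^sup>2)"
    by (rule summable_finite[of "{0}"]; simp add: u_def v_def)+
  ultimately show ?thesis
    unfolding trace_functionals_def by (intro CollectI exI[of _ u] exI[of _ v]) simp
qed

lemma topspace_weak_star [simp]: "topspace weak_star = (UNIV :: 'a::chilbert_space bop set)"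
proof -
  have "(\<lambda>T::'a bop. cinner (T \<cdot> 0) 0) -` UNIV
      \<in> {\<omega> -` S | \<omega> S. \<omega> \<in> trace_functionals \<and> open S}"
    using cinner_mem_trace_functionals by blast
  then show ?thesis unfolding weak_star_def topology_generated_by_topspace by blast
qed

lemma continuous_map_trace_functional:
  "\<omega> \<in> trace_functionals \<Longrightarrow> continuous_map weak_star euclidean \<omega>"
  unfolding continuous_map_def topspace_weak_star
  by (auto simp: weak_star_def vimage_def intro!: topology_generated_by_Basis)

text \<open>Convergence may be tested on a subbasis, by induction over the generation of the open
  sets: binary intersections and arbitrary unions keep the property.\<close>

lemma limitin_topology_generated_by:
  assumes "l \<in> \<Union>\<S>" and "\<And>U. U \<in> \<S> \<Longrightarrow> l \<in> U \<Longrightarrow> eventually (\<lambda>x. f x \<in> U) F"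
  shows "limitin (topology_generated_by \<S>) f l F"
  unfolding limitin_def
proof (intro conjI allI impI)
  show "l \<in> topspace (topology_generated_by \<S>)"
    using assms(1) by (simp add: topology_generated_by_topspace)
  fix U assume U: "openin (topology_generated_by \<S>) U \<and> l \<in> U"
  then have "generate_topology_on \<S> U" by (simp add: openin_topology_generated_by)
  then have "l \<in> U \<longrightarrow> eventually (\<lambda>x. f x \<in> U) F"
  proof induction
    case (UN K)
    show ?case
    proof
      assume "l \<in> \<Union>K"
      then obtain k where k: "k \<in> K" "l \<in> k" by blast
      then have "eventually (\<lambda>x. f x \<in> k) F" using UN by blast
      then show "eventually (\<lambda>x. f x \<in> \<Union>K) F" by eventually_elim (use k in blast)
    qed
  qed (use assms(2) in \<open>auto simp: eventually_conj_iff\<close>)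
  then show "eventually (\<lambda>x. f x \<in> U) F" using U by blast
qed

text \<open>On bounded sequences, convergence of all matrix coefficients is enough. A trace
  functional is a series of matrix coefficients, and Tannery's theorem exchanges limit and sum with
  the summable majorant \<open>C * (norm (\<xi> k) * norm (\<eta> k))\<close>.\<close>

lemma limitin_weak_starI:
  fixes X :: "nat \<Rightarrow> 'a::chilbert_space bop"
  assumes lim: "\<And>x y. (\<lambda>n. cinner (X n \<cdot> x) y) \<longlonglongrightarrow> cinner (T \<cdot> x) y"
    and bound: "\<And>n. norm (X n) \<le> C"
  shows "limitin weak_star X T sequentially"
  unfolding weak_star_def
proof (rule limitin_topology_generated_by)
  have "T \<in> topspace weak_star" by simp
  then show "T \<in> \<Union> {\<omega> -` S | \<omega> S. \<omega> \<in> trace_functionals \<and> open S}"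
    by (simp only: weak_star_def topology_generated_by_topspace)
  fix U assume "U \<in> {\<omega> -` S | \<omega> S. \<omega> \<in> (trace_functionals :: ('a bop \<Rightarrow> complex) set) \<and> open S}"
    and TU: "T \<in> U"
  then obtain \<omega> S where S: "U = \<omega> -` S" "\<omega> \<in> trace_functionals" "open S" by blast
  then obtain \<xi> \<eta> where \<omega>: "\<omega> = (\<lambda>T. \<Sum>n. cinner (T \<cdot> \<xi> n) (\<eta> n))"
    and sm: "summable (\<lambda>n. (norm (\<xi> n))\<^sup>2)" "summable (\<lambda>n. (norm (\<eta> n))\<^sup>2)"
    by (auto simp: trace_functionals_def)
  have le: "cmod (cinner (X n \<cdot> \<xi> k) (\<eta> k)) \<le> C * (norm (\<xi> k) * norm (\<eta> k))" for k n
  proof -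
    have "norm (X n \<cdot> \<xi> k) \<le> C * norm (\<xi> k)"
      using norm_bop_apply_le[of "X n" "\<xi> k"] mult_right_mono[OF bound[of n], of "norm (\<xi> k)"]
      by simp
    then have "norm (X n \<cdot> \<xi> k) * norm (\<eta> k) \<le> C * norm (\<xi> k) * norm (\<eta> k)"
      by (rule mult_right_mono) simp
    then show ?thesis using norm_cinner_le[of "X n \<cdot> \<xi> k" "\<eta> k"] by (simp add: mult.assoc)
  qed
  have "(\<lambda>n. \<omega> (X n)) \<longlonglongrightarrow> \<omega> T"
    unfolding \<omega>
    by (rule tannerys_theorem[where a = "\<lambda>k n. cinner (X n \<cdot> \<xi> k) (\<eta> k)"
          and M = "\<lambda>k. C * (norm (\<xi> k) * norm (\<eta> k))", THEN conjunct2, THEN conjunct2])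
      (auto intro!: lim summable_mult summable_mult_square sm always_eventually simp: le)
  then have "eventually (\<lambda>n. \<omega> (X n) \<in> S) sequentially"
    using S(1,3) TU by (auto dest: topological_tendstoD)
  then show "eventually (\<lambda>n. X n \<in> U) sequentially" using S(1) by simp
qed

lemma limitin_weak_starD:
  assumes "limitin weak_star X T F"
  shows "((\<lambda>n. cinner (X n \<cdot> x) y) \<longlongrightarrow> cinner (T \<cdot> x) (y::'a::chilbert_space)) F"
  using continuous_map_limit[OF continuous_map_trace_functional[OF cinner_mem_trace_functionals]
      assms, of x y]
  by (simp add: o_def)

lemma bop_cinner_eqI:
  "(\<And>x y. cinner (S \<cdot> x) y = cinner (T \<cdot> x) (y::'a::chilbert_space)) \<Longrightarrow> S = T"
  by (intro bop_eqI cinner_right_eqI)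

text \<open>A norm convergent sequence is bounded and its matrix coefficients converge, so it
  converges weak* to the same limit.\<close>

lemma weak_star_closed_imp_closed:
  fixes \<X> :: "'a::chilbert_space bop set"
  assumes "closedin weak_star \<X>"
  shows "closed \<X>"
proof (subst closed_sequential_limits, intro allI impI, elim conjE)
  fix X T assume X: "\<forall>n. X n \<in> \<X>" and lim: "X \<longlonglongrightarrow> T"
  obtain C where "\<And>n. norm (X n) \<le> C"
    using convergent_imp_Bseq[of X] lim by (auto simp: convergent_def Bseq_def)
  moreover have "(\<lambda>n. cinner (X n \<cdot> x) y) \<longlonglongrightarrow> cinner (T \<cdot> x) y" for x y
  proof (rule LIM_zero_cancel, rule Lim_null_comparison)
    show "\<forall>\<^sub>F n in sequentially. norm (cinner (X n \<cdot> x) y - cinner (T \<cdot> x) y)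
        \<le> norm (X n - T) * norm x * norm y"
    proof (rule always_eventually, rule allI)
      fix n
      have "cmod (cinner ((X n - T) \<cdot> x) y) \<le> norm ((X n - T) \<cdot> x) * norm y"
        by (rule norm_cinner_le)
      also have "\<dots> \<le> norm (X n - T) * norm x * norm y"
        by (intro mult_right_mono norm_bop_apply_le) simp
      finally show "norm (cinner (X n \<cdot> x) y - cinner (T \<cdot> x) y) \<le> norm (X n - T) * norm x * norm y"
        by (simp add: bop_minus_apply cinner_diff_left)
    qed
    show "(\<lambda>n. norm (X n - T) * norm x * norm y) \<longlonglongrightarrow> 0"
      using lim by (intro tendsto_mult_left_zero tendsto_norm_zero LIM_zero)
  qed
  ultimately have "limitin weak_star X T sequentially" by (rule limitin_weak_starI[rotated])
  then show "T \<in> \<X>" by (rule limitin_closedin) (use assms X in auto)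
qed

section \<open>Weak* sequential compactness of bounded sets of operators\<close>

text \<open>An \<open>e / 3\<close> argument with a nearby point of convergence \<open>z\<close>. It
  serves to spread convergence from a dense set to the whole space.\<close>

lemma closed_convergent_equi_lipschitz:
  fixes f :: "nat \<Rightarrow> 'a::metric_space \<Rightarrow> 'b::complete_space"
  assumes "\<And>n x y. dist (f n x) (f n y) \<le> L * dist x y"
  shows "closed {x. convergent (\<lambda>n. f n x)}"
proof -
  have "x \<in> {x. convergent (\<lambda>n. f n x)}" if "x \<in> closure {x. convergent (\<lambda>n. f n x)}" for x
  proof -
    have "Cauchy (\<lambda>n. f n x)"
    proof (rule metric_CauchyI)
      fix e :: real assume e: "0 < e"
      define d where "d = e / (3 * (\<bar>L\<bar> + 1))"
      have d: "d > 0" using e by (simp add: d_def)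
      obtain z where z: "convergent (\<lambda>n. f n z)" "dist z x < d"
        using \<open>x \<in> closure _\<close> d by (auto simp: closure_approachable)
      have L: "dist (f n z) (f n x) < e / 3" for n
      proof -
        have "dist (f n z) (f n x) \<le> (\<bar>L\<bar> + 1) * dist z x"
          using assms[of n z x] mult_right_mono[of L "\<bar>L\<bar> + 1" "dist z x"]
          by (smt (verit) zero_le_dist)
        also have "\<dots> < (\<bar>L\<bar> + 1) * d"
          by (rule mult_strict_left_mono[OF z(2)]) simp
        also have "\<dots> = e / 3" by (simp add: d_def field_simps)
        finally show ?thesis .
      qed
      obtain N where N: "\<And>i j. i \<ge> N \<Longrightarrow> j \<ge> N \<Longrightarrow> dist (f i z) (f j z) < e / 3"
        using metric_CauchyD[OF convergent_Cauchy[OF z(1)], of "e / 3"] e by auto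
      have "dist (f i x) (f j x) < e" if "i \<ge> N" "j \<ge> N" for i j
        using L[of i] L[of j] N[OF that] dist_triangle[of "f i x" "f j x" "f i z"]
          dist_triangle[of "f i z" "f j x" "f j z"] dist_commute[of "f i x" "f i z"]
        by linarith
      then show "\<exists>N. \<forall>i\<ge>N. \<forall>j\<ge>N. dist (f i x) (f j x) < e" by blast
    qed
    then show ?thesis by (simp add: Cauchy_convergent)
  qed
  then show ?thesis by (metis closure_subset_eq subsetI)
qed

text \<open>A diagonal argument makes the matrix coefficients converge on a countable dense set, the
  common Lipschitz bound extends this to all vectors, and the limit is a bounded sesquilinear form,
  hence given by an operator.\<close>

lemma bounded_imp_weak_star_subsequence:
  fixes X :: "nat \<Rightarrow> 'a::chilbert_space bop"
  assumes separable: "\<exists>S :: 'a set. countable S \<and> closure S = UNIV"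
    and bound: "\<And>n. norm (X n) \<le> C"
  obtains r T where "strict_mono r" "limitin weak_star (X \<circ> r) T sequentially"
proof -
  obtain S :: "'a set" where S: "countable S" "closure S = UNIV" using separable by blast
  have C: "C \<ge> 0" using bound[of 0] norm_ge_zero order_trans by blast
  have le: "cmod (cinner (X n \<cdot> x) y) \<le> C * norm x * norm y" for n x y
  proof -
    have "norm (X n \<cdot> x) \<le> C * norm x"
      using norm_bop_apply_le[of "X n" x] mult_right_mono[OF bound[of n], of "norm x"]
      by simp
    then have "norm (X n \<cdot> x) * norm y \<le> C * norm x * norm y"
      by (rule mult_right_mono) simp
    then show ?thesis using norm_cinner_le[of "X n \<cdot> x" "y"] by simp
  qed
  \<comment> \<open>The diagonal argument asks for one bound common to all pairs, hence the division
    by the norms. Pairs with a zero vector get the value \<open>0\<close>.\<close>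
  define f where "f n p = cinner (X n \<cdot> fst p) (snd p) / of_real (norm (fst p) * norm (snd p))"
    for n p
  have f_le: "norm (f n p) \<le> C" for n p
    using le[of n "fst p" "snd p"] C
    by (cases "fst p = 0 \<or> snd p = 0") (auto simp: f_def norm_divide norm_mult field_simps)
  obtain r where r: "strict_mono r"
    "\<And>p. p \<in> S \<times> S \<Longrightarrow> \<exists>l. (\<lambda>n. f (r n) p) \<longlonglongrightarrow> l"
    by (rule function_convergent_subsequence[of "S \<times> S" f C]) (use S(1) f_le in auto)
  define g where "g n x y = cinner (X (r n) \<cdot> x) y" for n x y
  have g_le: "cmod (g n x y) \<le> C * norm x * norm y" for n x y unfolding g_def by (rule le)
  have gdl: "g n (x - x') y = g n x y - g n x' y" and gdr: "g n x (y - y') = g n x y - g n x y'"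
    for n x x' y y'
    by (simp_all add: g_def bop_diff cinner_diff_left cinner_diff_right)
  have SS: "convergent (\<lambda>n. g n x y)" if "x \<in> S" "y \<in> S" for x y
  proof -
    obtain l where "(\<lambda>n. f (r n) (x, y)) \<longlonglongrightarrow> l" using r(2)[of "(x, y)"] \<open>x \<in> S\<close> \<open>y \<in> S\<close> by auto
    then have "(\<lambda>n. f (r n) (x, y) * of_real (norm x * norm y)) \<longlonglongrightarrow> l * of_real (norm x * norm y)"
      by (intro tendsto_intros)
    \<comment> \<open>The simplified instance of \<open>bop_diff\<close> says that operators vanish
      at \<open>0\<close>, which settles the degenerate pairs.\<close>
    moreover have "f (r n) (x, y) * of_real (norm x * norm y) = g n x y" for n
      by (cases "x = 0 \<or> y = 0") (auto simp: f_def g_def bop_diff[of _ x x, simplified])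
    ultimately show ?thesis by (auto simp: convergent_def)
  qed
  \<comment> \<open>Convergence is extended one variable at a time: first to all \<open>x\<close>
    with \<open>y\<close> in \<open>S\<close>, then to all \<open>y\<close>.\<close>
  have "closed {x. convergent (\<lambda>n. g n x y)}" for y
    by (rule closed_convergent_equi_lipschitz[of _ "C * norm y"])
      (use g_le[of _ "_ - _" y] in \<open>simp add: dist_norm gdl[symmetric] mult_ac\<close>)
  then have "closure S \<subseteq> {x. convergent (\<lambda>n. g n x y)}" if "y \<in> S" for y
    using SS that by (intro closure_minimal) auto
  then have US: "convergent (\<lambda>n. g n x y)" if "y \<in> S" for x y using S(2) that by blast
  have "closed {y. convergent (\<lambda>n. g n x y)}" for x
    by (rule closed_convergent_equi_lipschitz[of _ "C * norm x"])
      (use g_le[of _ x "_ - _"] in \<open>simp add: dist_norm gdr[symmetric] mult_ac\<close>)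
  then have "closure S \<subseteq> {y. convergent (\<lambda>n. g n x y)}" for x
    using US by (intro closure_minimal) auto
  then have "convergent (\<lambda>n. g n x y)" for x y using S(2) by blast
  then have "\<exists>l. (\<lambda>n. g n x y) \<longlonglongrightarrow> l" for x y by (simp add: convergent_def)
  then obtain b where b: "\<And>x y. (\<lambda>n. g n x y) \<longlonglongrightarrow> b x y" by metis
  obtain T where T: "\<And>x y. cinner (T \<cdot> x) y = b x y"
  proof (rule bounded_sesquilinear_bop[of b C])
    show "b (x + x') y = b x y + b x' y" for x x' y
      using tendsto_add[OF b[of x y] b[of x' y]] b[of "x + x'" y]
      by (intro LIMSEQ_unique) (simp_all add: g_def bop_add cinner_add_left)
    show "b x (y + y') = b x y + b x y'" for x y y'
      using tendsto_add[OF b[of x y] b[of x y']] b[of x "y + y'"]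
      by (intro LIMSEQ_unique) (simp_all add: g_def cinner_add_right)
    show "b (a *\<^sub>C x) y = a * b x y" for a x y
      using tendsto_mult_left[OF b[of x y], of a] b[of "a *\<^sub>C x" y]
      by (intro LIMSEQ_unique) (simp_all add: g_def bop_scaleC cinner_scaleC_left)
    show "b x (a *\<^sub>C y) = cnj a * b x y" for a x y
      using tendsto_mult_left[OF b[of x y], of "cnj a"] b[of x "a *\<^sub>C y"]
      by (intro LIMSEQ_unique) (simp_all add: g_def cinner_scaleC_right)
    show "cmod (b x y) \<le> C * norm x * norm y" for x y
      by (rule LIMSEQ_le_const2[OF tendsto_norm[OF b[of x y]]]) (use g_le in auto)
  qed (use C in auto)
  have "limitin weak_star (X \<circ> r) T sequentially"
    by (rule limitin_weak_starI[of _ _ C]) (use b bound in \<open>simp_all add: T g_def\<close>)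
  then show ?thesis using that r(1) by blast
qed

text \<open>Weak* lower semicontinuity of the norm: a norm bound is a family of bounds on matrix
  coefficients, and each of these passes to the limit.\<close>

lemma norm_limitin_weak_star_le:
  assumes "limitin weak_star X T F" "F \<noteq> bot" "eventually (\<lambda>n. norm (S - X n) \<le> c) F" "0 \<le> c"
  shows "norm (S - T :: 'a::chilbert_space bop) \<le> c"
proof (rule norm_bop_leI)
  fix x
  show "norm ((S - T) \<cdot> x) \<le> c * norm x"
  proof (rule norm_le_cinnerI)
    fix y
    have "((\<lambda>n. cinner (S \<cdot> x) y - cinner (X n \<cdot> x) y) \<longlongrightarrow>
        cinner (S \<cdot> x) y - cinner (T \<cdot> x) y) F"
      by (intro tendsto_intros limitin_weak_starD[OF assms(1)])
    then have "((\<lambda>n. cinner ((S - X n) \<cdot> x) y) \<longlongrightarrow> cinner ((S - T) \<cdot> x) y) F"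
      by (simp add: bop_minus_apply cinner_diff_left)
    from tendsto_norm[OF this] show "cmod (cinner ((S - T) \<cdot> x) y) \<le> c * norm x * norm y"
    proof (rule tendsto_upperbound[OF _ _ assms(2)])
      show "eventually (\<lambda>n. norm (cinner ((S - X n) \<cdot> x) y) \<le> c * norm x * norm y) F"
        using assms(3)
      proof eventually_elim
        case (elim n)
        have "cmod (cinner ((S - X n) \<cdot> x) y) \<le> norm ((S - X n) \<cdot> x) * norm y"
          by (rule norm_cinner_le)
        also have "\<dots> \<le> norm (S - X n) * norm x * norm y"
          by (intro mult_right_mono norm_bop_apply_le) simp
        also have "\<dots> \<le> c * norm x * norm y"
          using elim by (intro mult_right_mono) simp_all
        finally show ?case .
      qed
    qed
  qed (use assms(4) in simp)
qed (fact assms(4))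

section \<open>Hyperreflexivity\<close>

text \<open>Any fixed \<open>X\<close> in \<open>\<X>\<close> bounds all the distances by
  \<open>norm (T - X)\<close>, so the supremum in \<open>alpha\<close> is a genuine one.\<close>

lemma alpha_bdd_above:
  assumes "\<X> \<noteq> {}"
  shows "bdd_above (insert 0 {infdist (T \<cdot> \<xi>) ((\<lambda>X. X \<cdot> \<xi>) ` \<X>) | \<xi>. norm \<xi> = 1})"
proof -
  obtain X where X: "X \<in> \<X>" using assms by blast
  have "infdist (T \<cdot> \<xi>) ((\<lambda>X. X \<cdot> \<xi>) ` \<X>) \<le> norm (T - X)" if "norm \<xi> = 1" for \<xi>
    using infdist_le[of "X \<cdot> \<xi>" "(\<lambda>X. X \<cdot> \<xi>) ` \<X>" "T \<cdot> \<xi>"] X that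
      norm_bop_apply_le[of "T - X" \<xi>]
    by (auto simp: dist_norm bop_minus_apply)
  then have "x \<le> norm (T - X)"
    if "x \<in> insert 0 {infdist (T \<cdot> \<xi>) ((\<lambda>X. X \<cdot> \<xi>) ` \<X>) | \<xi>. norm \<xi> = 1}" for x
    using that by auto
  then show ?thesis by (auto simp: bdd_above_def)
qed

lemma alpha_nonneg:
  assumes "\<X> \<noteq> {}"
  shows "0 \<le> alpha T \<X>"
  unfolding alpha_def by (rule cSup_upper[OF _ alpha_bdd_above[OF assms]]) simp

lemma infdist_apply_le_alpha:
  assumes "\<X> \<noteq> {}" "norm \<xi> = 1"
  shows "infdist (T \<cdot> \<xi>) ((\<lambda>X. X \<cdot> \<xi>) ` \<X>) \<le> alpha T \<X>"
  unfolding alpha_def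
  by (rule cSup_upper[OF _ alpha_bdd_above[OF assms(1)]]) (use assms(2) in blast)

lemma alpha_leI:
  assumes "0 \<le> c" "\<And>\<xi>. norm \<xi> = 1 \<Longrightarrow> infdist (T \<cdot> \<xi>) ((\<lambda>X. X \<cdot> \<xi>) ` \<X>) \<le> c"
  shows "alpha T \<X> \<le> c"
  unfolding alpha_def by (rule cSup_least) (use assms in auto)

lemma alpha_antimono:
  assumes "\<W> \<subseteq> \<X>" "\<W> \<noteq> {}"
  shows "alpha T \<X> \<le> alpha T \<W>"
proof (rule alpha_leI)
  fix \<xi> :: 'a assume "norm \<xi> = 1"
  have "infdist (T \<cdot> \<xi>) ((\<lambda>X. X \<cdot> \<xi>) ` \<X>) \<le> infdist (T \<cdot> \<xi>) ((\<lambda>X. X \<cdot> \<xi>) ` \<W>)"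
    by (rule infdist_mono) (use assms in auto)
  also have "\<dots> \<le> alpha T \<W>" by (rule infdist_apply_le_alpha) fact+
  finally show "infdist (T \<cdot> \<xi>) ((\<lambda>X. X \<cdot> \<xi>) ` \<X>) \<le> alpha T \<W>" .
qed (rule alpha_nonneg[OF assms(2)])

lemma alpha_triangle:
  assumes "\<X> \<noteq> {}"
  shows "alpha S \<X> \<le> alpha T \<X> + norm (S - T)"
proof (rule alpha_leI)
  fix \<xi> :: 'a assume \<xi>: "norm \<xi> = 1"
  have "infdist (S \<cdot> \<xi>) ((\<lambda>X. X \<cdot> \<xi>) ` \<X>)
      \<le> infdist (T \<cdot> \<xi>) ((\<lambda>X. X \<cdot> \<xi>) ` \<X>) + dist (S \<cdot> \<xi>) (T \<cdot> \<xi>)"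
    by (rule infdist_triangle)
  also have "\<dots> \<le> alpha T \<X> + norm (S - T)"
    using norm_bop_apply_le[of "S - T" \<xi>] \<xi> infdist_apply_le_alpha[OF assms \<xi>]
    by (intro add_mono) (auto simp: dist_norm bop_minus_apply)
  finally show "infdist (S \<cdot> \<xi>) ((\<lambda>X. X \<cdot> \<xi>) ` \<X>) \<le> alpha T \<X> + norm (S - T)" .
qed (use alpha_nonneg[OF assms] in simp)

lemma exists_dist_le_infdist_add:
  assumes "A \<noteq> {}" "0 < e"
  obtains a where "a \<in> A" "dist x a < infdist x A + e"
proof -
  have "(INF a\<in>A. dist x a) < infdist x A + e" using assms by (simp add: infdist_notempty)
  then obtain d where "d \<in> dist x ` A" "d < infdist x A + e"
    using cInf_lessD[of "dist x ` A"] assms(1) by auto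
  then show ?thesis using that by auto
qed

text \<open>Hyperreflexive spaces are reflexive: the pointwise condition makes
  \<open>alpha T \<X>\<close> vanish, hence the distance from \<open>T\<close> to the norm closed
  set \<open>\<X>\<close>.\<close>

lemma hyperreflexive_membership:
  assumes "hyperreflexive \<X>" and "\<And>\<xi>. T \<cdot> \<xi> \<in> closure ((\<lambda>X. X \<cdot> \<xi>) ` \<X>)"
  shows "T \<in> \<X>"
proof -
  obtain k where k: "k > 0" "\<And>T. infdist T \<X> \<le> k * alpha T \<X>"
    and X: "csubspace \<X>" "closedin weak_star \<X>"
    using assms(1) by (auto simp: hyperreflexive_def weak_star_closed_subspace_def)
  have ne: "\<X> \<noteq> {}" using X(1) by (auto simp: complex_vector.subspace_def)
  have "infdist (T \<cdot> \<xi>) ((\<lambda>X. X \<cdot> \<xi>) ` \<X>) = 0" for \<xi>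
    using assms(2)[of \<xi>] ne by (subst (asm) in_closure_iff_infdist_zero) auto
  then have "alpha T \<X> \<le> 0" by (intro alpha_leI) auto
  then have "infdist T \<X> \<le> 0"
    using k(2)[of T] mult_left_mono[of "alpha T \<X>" 0 k] k(1) by simp
  then have "infdist T \<X> = 0" using infdist_nonneg[of T \<X>] by linarith
  then show ?thesis
    using in_closed_iff_infdist_zero[OF weak_star_closed_imp_closed[OF X(2)] ne] by simp
qed

section \<open>Schur idempotents\<close>

text \<open>The identity is the projection to the whole space, which is invariant under the
  masa.\<close>

lemma masa_unit:
  assumes "masa (\<D> :: 'a::chilbert_space bop set)"
  obtains I where "I \<in> \<D>" "\<And>x. I \<cdot> x = x"
  by (rule invariant_projection_in_masa[OF assms complex_vector.subspace_UNIV closed_UNIV]) auto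

text \<open>If \<open>P\<close> and \<open>1 - Q\<close> are the projections to the closures of \<open>\<D> \<xi>\<close> and \<open>\<U> \<xi>\<close>, then both lie in
  the masa and \<open>Q X P = 0\<close> for \<open>X \<in> \<U>\<close>, so that \<open>Q \<Phi>(X) P = \<Phi>(Q X P) = 0\<close>. For a general
  masa-bimodule one would need a structure theorem for \<open>\<Phi>\<close> here.\<close>

lemma schur_idempotent_preserves:
  fixes \<D> \<U> :: "'a::chilbert_space bop set"
  assumes "masa \<D>" "masa_bimodule \<D> \<U>" "hyperreflexive \<U>" "schur_idempotent \<D> \<Phi>" and X: "X \<in> \<U>"
  shows "\<Phi> X \<in> \<U>"
proof (rule hyperreflexive_membership[OF assms(3)])
  fix \<xi> :: 'a
  obtain I where I: "I \<in> \<D>" "\<And>x. I \<cdot> x = x" by (rule masa_unit[OF assms(1)]) auto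
  have \<D>: "csubspace \<D>" "\<And>A B. A \<in> \<D> \<Longrightarrow> B \<in> \<D> \<Longrightarrow> A * B \<in> \<D>"
    using assms(1) by (auto simp: masa_def abelian_selfadjoint_algebra_def)
  have \<U>: "csubspace \<U>" "\<And>A X B. A \<in> \<D> \<Longrightarrow> X \<in> \<U> \<Longrightarrow> B \<in> \<D> \<Longrightarrow> A * X * B \<in> \<U>"
    using assms(2) by (auto simp: masa_bimodule_def weak_star_closed_subspace_def)
  have \<Phi>: "\<And>A T B. A \<in> \<D> \<Longrightarrow> B \<in> \<D> \<Longrightarrow> \<Phi> (A * T * B) = A * \<Phi> T * B" "clinear \<Phi>"
    using assms(4) by (auto simp: schur_idempotent_def)
  have I_unit: "I * T = T" "T * I = T" for T
    by (auto intro!: bop_eqI simp: bop_times_apply I)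
  define M where "M = closure ((\<lambda>X. X \<cdot> \<xi>) ` \<U>)"
  define N where "N = closure ((\<lambda>A. A \<cdot> \<xi>) ` \<D>)"
  have map: "T \<cdot> x \<in> closure B" if "x \<in> closure A" "\<And>a. a \<in> A \<Longrightarrow> T \<cdot> a \<in> B"
    for T :: "'a bop" and x A B
  proof -
    have "(\<lambda>x. T \<cdot> x) ` closure A \<subseteq> closure ((\<lambda>x. T \<cdot> x) ` A)"
      by (intro image_closure_subset closure_subset closed_closure linear_continuous_on
          bounded_linear_bop)
    also have "\<dots> \<subseteq> closure B" using that(2) by (intro closure_mono) auto
    finally show ?thesis using that(1) by (rule subsetD[OF _ imageI])
  qed
  have csub: "csubspace M" "csubspace N"
    unfolding M_def N_def using \<U>(1) \<D>(1)
    by (auto intro!: csubspace_closure_image simp: bop_plus_apply bop_scaleC_apply)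
  have M_inv: "A \<cdot> x \<in> M" if "A \<in> \<D>" "x \<in> M" for A x
    using that(2) unfolding M_def
  proof (rule map)
    fix a assume "a \<in> (\<lambda>X. X \<cdot> \<xi>) ` \<U>"
    then obtain Y where Y: "Y \<in> \<U>" "a = Y \<cdot> \<xi>" by blast
    \<comment> \<open>The bimodule condition is two-sided; the unit \<open>I\<close> supplies the
      missing factor here and in the product \<open>X * A\<close> below.\<close>
    have "A * Y \<in> \<U>" using \<U>(2)[OF that(1) Y(1) I(1)] by (simp add: I_unit)
    then show "A \<cdot> a \<in> (\<lambda>X. X \<cdot> \<xi>) ` \<U>"
      unfolding Y(2) bop_times_apply[symmetric] by blast
  qed
  have N_inv: "A \<cdot> x \<in> N" if "A \<in> \<D>" "x \<in> N" for A x
    using that(2) unfolding N_def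
  proof (rule map)
    fix a assume "a \<in> (\<lambda>X. X \<cdot> \<xi>) ` \<D>"
    then obtain Y where Y: "Y \<in> \<D>" "a = Y \<cdot> \<xi>" by blast
    then show "A \<cdot> a \<in> (\<lambda>X. X \<cdot> \<xi>) ` \<D>"
      unfolding Y(2) bop_times_apply[symmetric] using \<D>(2)[OF that(1)] by blast
  qed
  have NM: "X \<cdot> x \<in> M" if "x \<in> N" for x
    using that unfolding M_def N_def
  proof (rule map)
    fix a assume "a \<in> (\<lambda>A. A \<cdot> \<xi>) ` \<D>"
    then obtain A where A: "A \<in> \<D>" "a = A \<cdot> \<xi>" by blast
    have "X * A \<in> \<U>" using \<U>(2)[OF I(1) X A(1)] by (simp add: I_unit)
    then show "X \<cdot> a \<in> (\<lambda>X. X \<cdot> \<xi>) ` \<U>"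
      unfolding A(2) bop_times_apply[symmetric] by blast
  qed
  obtain R where R: "R \<in> \<D>" "\<And>x. R \<cdot> x \<in> M" "\<And>x. x \<in> M \<Longrightarrow> R \<cdot> x = x"
    by (rule invariant_projection_in_masa[OF assms(1) csub(1) _ M_inv]) (auto simp: M_def)
  obtain P where P: "P \<in> \<D>" "\<And>x. P \<cdot> x \<in> N" "\<And>x. x \<in> N \<Longrightarrow> P \<cdot> x = x"
    by (rule invariant_projection_in_masa[OF assms(1) csub(2) _ N_inv]) (auto simp: N_def)
  define Q where "Q = I - R"
  have Q: "Q \<in> \<D>" unfolding Q_def using \<D>(1) I(1) R(1) by (rule complex_vector.subspace_diff)
  \<comment> \<open>\<open>P\<close> maps into \<open>N\<close>, \<open>X\<close> maps
    \<open>N\<close> into \<open>M\<close>, and \<open>Q = I - R\<close> annihilates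
    \<open>M\<close>.\<close>
  have "Q * X * P = 0"
    by (rule bop_eqI) (simp add: Q_def bop_times_apply bop_minus_apply I R P NM)
  moreover have "\<Phi> 0 = 0"
    using \<Phi>(2) unfolding linear_iff_module_hom by (rule module_hom.zero)
  ultimately have 0: "Q * \<Phi> X * P = 0" using \<Phi>(1)[OF Q P(1), of X] by simp
  have "\<xi> \<in> N"
  proof -
    have "I \<cdot> \<xi> \<in> N" unfolding N_def
      by (rule subsetD[OF closure_subset imageI[OF I(1)]])
    then show ?thesis by (simp only: I)
  qed
  \<comment> \<open>As \<open>\<xi>\<close> lies in \<open>N\<close>, it is fixed by
    \<open>P\<close>. The vanishing of the left side then says that \<open>R\<close> fixes
    \<open>\<Phi> X \<cdot> \<xi>\<close>, so this vector is in \<open>M\<close>.\<close>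
  then have "(Q * \<Phi> X * P) \<cdot> \<xi> = \<Phi> X \<cdot> \<xi> - R \<cdot> \<Phi> X \<cdot> \<xi>"
    by (simp add: bop_times_apply P(3) Q_def bop_minus_apply I)
  then have "R \<cdot> \<Phi> X \<cdot> \<xi> = \<Phi> X \<cdot> \<xi>" by (simp add: 0)
  then show "\<Phi> X \<cdot> \<xi> \<in> closure ((\<lambda>X. X \<cdot> \<xi>) ` \<U>)"
    using R(2)[of "\<Phi> X \<cdot> \<xi>"] by (simp add: M_def)
qed

section \<open>Approximants in the intersection with the range of one idempotent\<close>

text \<open>The set \<open>\<W>\<close> lies in both spaces, so \<open>alpha T\<close> of either is
  at most \<open>alpha T \<W>\<close>. With \<open>\<W>\<close> taken as
  \<open>\<U> \<inter> \<V>\<close> the bound is the same for all members of an approximating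
  sequence.\<close>

lemma approximation_in_inter_range:
  fixes \<D> \<U> :: "'a::chilbert_space bop set"
  assumes "masa \<D>" "masa_bimodule \<D> \<U>" "hyperreflexive \<U>" "schur_idempotent \<D> \<Phi>"
    and k: "0 < k" "infdist T \<U> \<le> k * alpha T \<U>"
    and l: "0 < l" "\<And>S. norm (S - \<Phi> S) \<le> l * alpha S (range \<Phi>)"
    and W: "\<W> \<subseteq> \<U> \<inter> range \<Phi>" "\<W> \<noteq> {}" and e: "0 < e"
  obtains Y where "Y \<in> \<U> \<inter> range \<Phi>" "norm (T - Y) < (l + k + l * k) * alpha T \<W> + e"
proof -
  let ?a = "alpha T \<W>"
  \<comment> \<open>The error in the choice of \<open>X\<close> enters the final estimate with the
    factor \<open>1 + l\<close>.\<close>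
  define d where "d = e / (1 + l)"
  have d: "0 < d" using e l(1) by (simp add: d_def)
  have "\<U> \<noteq> {}" using W by blast
  then obtain X where X: "X \<in> \<U>" "dist T X < infdist T \<U> + d"
    using d by (rule exists_dist_le_infdist_add)
  have "k * alpha T \<U> \<le> k * ?a"
    using W k(1) by (intro mult_left_mono alpha_antimono) auto
  then have X_le: "norm (T - X) < k * ?a + d"
    using X(2) k(2) by (simp add: dist_norm)
  have "alpha X (range \<Phi>) \<le> alpha T (range \<Phi>) + norm (X - T)"
    by (rule alpha_triangle) simp
  also have "\<dots> \<le> ?a + norm (T - X)"
    using W by (intro add_mono alpha_antimono) (auto simp: norm_minus_commute)
  finally have "norm (X - \<Phi> X) \<le> l * (?a + norm (T - X))"
    using l(2)[of X] mult_left_mono[of "alpha X (range \<Phi>)" "?a + norm (T - X)" l] l(1) by linarith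
  then have "norm (T - \<Phi> X) \<le> norm (T - X) + l * (?a + norm (T - X))"
    using norm_triangle_ineq[of "T - X" "X - \<Phi> X"] by simp
  also have "\<dots> = (1 + l) * norm (T - X) + l * ?a" by (simp add: algebra_simps)
  also have "\<dots> < (1 + l) * (k * ?a + d) + l * ?a"
    using X_le l(1) by simp
  \<comment> \<open>The constant of the theorem arises as \<open>(1 + l) * k + l\<close>.\<close>
  also have "\<dots> = (l + k + l * k) * ?a + e"
    using l(1) by (simp add: d_def field_simps)
  finally have "norm (T - \<Phi> X) < (l + k + l * k) * ?a + e" .
  moreover have "\<Phi> X \<in> \<U> \<inter> range \<Phi>"
    using schur_idempotent_preserves[OF assms(1-4) X(1)] by blast
  ultimately show ?thesis by (rule that[rotated])
qed

section \<open>Ranges of Schur idempotents\<close>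

lemma schur_idempotent_range:
  "schur_idempotent \<D> \<Phi> \<Longrightarrow> X \<in> range \<Phi> \<longleftrightarrow> \<Phi> X = X"
  unfolding schur_idempotent_def fun_eq_iff o_def by (metis rangeE rangeI)

text \<open>The range is the set of fixed points of \<Phi>. It is weak* closed as the intersection
  of the zero sets of the matrix coefficients of \<open>\<Phi> T - T\<close>, which are continuous
  in \<open>T\<close>.\<close>

lemma masa_bimodule_range_schur_idempotent:
  fixes \<D> :: "'a::chilbert_space bop set"
  assumes "schur_idempotent \<D> \<Phi>"
  shows "masa_bimodule \<D> (range \<Phi>)"
  unfolding masa_bimodule_def weak_star_closed_subspace_def
proof (intro conjI ballI)
  have \<Phi>: "clinear \<Phi>" "continuous_map weak_star weak_star \<Phi>"
    "\<And>A T B. A \<in> \<D> \<Longrightarrow> B \<in> \<D> \<Longrightarrow> \<Phi> (A * T * B) = A * \<Phi> T * B"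
    using assms by (auto simp: schur_idempotent_def)
  show "csubspace (range \<Phi>)"
    using \<Phi>(1) complex_vector.subspace_UNIV
    unfolding linear_iff_module_hom by (rule module_hom.subspace_image)
  have "range \<Phi> = {T. \<forall>x y. cinner (\<Phi> T \<cdot> x) y = cinner (T \<cdot> x) y}"
  proof (intro equalityI subsetI CollectI allI)
    fix T assume "T \<in> {T. \<forall>x y. cinner (\<Phi> T \<cdot> x) y = cinner (T \<cdot> x) y}"
    then have "\<Phi> T = T" by (intro bop_cinner_eqI) simp
    then show "T \<in> range \<Phi>" by (simp only: schur_idempotent_range[OF assms])
  qed (simp only: schur_idempotent_range[OF assms])
  also have "\<dots> = (\<Inter>x. \<Inter>y. {T \<in> topspace weak_star.
      cinner (\<Phi> T \<cdot> x) y - cinner (T \<cdot> x) y \<in> {0}})"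
    by (simp only: topspace_weak_star UNIV_I simp_thms singleton_iff right_minus_eq) blast
  also have "closedin weak_star \<dots>"
  proof -
    have "continuous_map weak_star euclidean (\<lambda>T. cinner (\<Phi> T \<cdot> x) y - cinner (T \<cdot> x) y)" for x y
    proof (rule continuous_map_diff)
      show \<omega>: "continuous_map weak_star euclidean (\<lambda>T. cinner (T \<cdot> x) y)"
        by (rule continuous_map_trace_functional[OF cinner_mem_trace_functionals])
      show "continuous_map weak_star euclidean (\<lambda>T. cinner (\<Phi> T \<cdot> x) y)"
        using continuous_map_compose[OF \<Phi>(2) \<omega>] by (simp only: o_def)
    qed
    then have "closedin weak_star {T \<in> topspace weak_star.
        cinner (\<Phi> T \<cdot> x) y - cinner (T \<cdot> x) y \<in> {0}}" for x y
      by (rule closedin_continuous_map_preimage) simp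
    then show ?thesis by (intro closedin_INT UNIV_not_empty)
  qed
  finally show "closedin weak_star (range \<Phi>)" .
  fix A X B assume "A \<in> \<D>" "X \<in> range \<Phi>" "B \<in> \<D>"
  then have "\<Phi> (A * X * B) = A * X * B"
    by (simp add: \<Phi>(3) schur_idempotent_range[OF assms])
  then show "A * X * B \<in> range \<Phi>" by (simp only: schur_idempotent_range[OF assms])
qed

text \<open>\<open>\<Phi> T\<close> is itself a competitor in the distance from \<open>T\<close> to
  the range. Hyperreflexivity allows these ranges to take the place of \<open>\<U>\<close> in
  \<open>schur_idempotent_preserves\<close>.\<close>

lemma schur_H_hyperreflexive_range:
  assumes "\<Phi> \<in> schur_H \<D>"
  shows "hyperreflexive (range \<Phi>)"
proof -
  obtain l where l: "0 < l" "\<And>T. norm (T - \<Phi> T) \<le> l * alpha T (range \<Phi>)"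
    and \<Phi>: "schur_idempotent \<D> \<Phi>"
    using assms by (auto simp: schur_H_def)
  have "infdist T (range \<Phi>) \<le> l * alpha T (range \<Phi>)" for T
    using infdist_le[of "\<Phi> T" "range \<Phi>" T] l(2)[of T] by (simp add: dist_norm)
  then show ?thesis
    using masa_bimodule_range_schur_idempotent[OF \<Phi>] l(1)
    by (auto simp: hyperreflexive_def masa_bimodule_def)
qed

text \<open>The hypothesis \<open>\<Phi> (Suc n) \<circ> \<Phi> n = \<Phi> (Suc n)\<close> is an inclusion of kernels. It gives the one
  of ranges because \<open>\<Phi> (Suc n)\<close> preserves the hyperreflexive masa-bimodule \<open>range (\<Phi> n)\<close>.\<close>

lemma H_approximation_range_antimono:
  assumes "masa \<D>" "H_approximation \<D> \<V> \<Phi>" "m \<le> n"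
  shows "range (\<Phi> n) \<subseteq> range (\<Phi> m)"
  using assms(3)
proof (rule lift_Suc_antimono_le[of "\<lambda>n. range (\<Phi> n)", rotated])
  fix n
  have \<Phi>: "schur_idempotent \<D> (\<Phi> n)" "schur_idempotent \<D> (\<Phi> (Suc n))" "\<Phi> n \<in> schur_H \<D>"
    "\<Phi> (Suc n) \<circ> \<Phi> n = \<Phi> (Suc n)"
    using assms(2) by (auto simp: H_approximation_def decreases_to_def)
  \<comment> \<open>\<open>\<Phi> (Suc n) T\<close> equals
    \<open>\<Phi> (Suc n) (\<Phi> n T)\<close>, the image of an element of
    \<open>range (\<Phi> n)\<close>.\<close>
  have "\<Phi> (Suc n) T \<in> range (\<Phi> n)" for T
    using schur_idempotent_preserves[OF assms(1) masa_bimodule_range_schur_idempotent[OF \<Phi>(1)]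
        schur_H_hyperreflexive_range[OF \<Phi>(3)] \<Phi>(2) rangeI, of T] fun_cong[OF \<Phi>(4), of T]
    by simp
  then show "range (\<Phi> (Suc n)) \<subseteq> range (\<Phi> n)" by blast
qed

section \<open>Passage to the limit along the decreasing sequence\<close>

lemma infdist_inter_le:
  fixes \<D> \<U> \<V> :: "'a::chilbert_space bop set"
  assumes separable: "\<exists>S :: 'a set. countable S \<and> closure S = UNIV"
    and masa: "masa \<D>" and U: "masa_bimodule \<D> \<U>" "hyperreflexive \<U>"
    and V: "H_approximation \<D> \<V> \<Phi>"
    and k: "0 < k" "infdist T \<U> \<le> k * alpha T \<U>"
    and l: "0 < l" "\<And>n S. norm (S - \<Phi> n S) \<le> l * alpha S (range (\<Phi> n))"
  shows "infdist T (\<U> \<inter> \<V>) \<le> (l + k + l * k) * alpha T (\<U> \<inter> \<V>)"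
proof -
  define c where "c = (l + k + l * k) * alpha T (\<U> \<inter> \<V>)"
  have \<Phi>: "\<And>n. schur_idempotent \<D> (\<Phi> n)" and \<V>: "\<V> = (\<Inter>n. range (\<Phi> n))"
    using V by (auto simp: H_approximation_def decreases_to_def)
  have closed: "closedin weak_star \<U>" "closedin weak_star (range (\<Phi> n))"
    and zero: "0 \<in> \<U>" "0 \<in> range (\<Phi> n)" for n
    using U(1) masa_bimodule_range_schur_idempotent[OF \<Phi>]
    by (auto simp: masa_bimodule_def weak_star_closed_subspace_def complex_vector.subspace_def)
  have ne: "\<U> \<inter> \<V> \<noteq> {}" using zero by (auto simp: \<V>)
  have c: "0 \<le> c" unfolding c_def using k(1) l(1) alpha_nonneg[OF ne] by simp
  \<comment> \<open>The bound \<open>c\<close> does not depend on \<open>n\<close>, and the errors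
    \<open>inverse (Suc n)\<close> disappear in the limit.\<close>
  have "\<exists>Y \<in> \<U> \<inter> range (\<Phi> n). norm (T - Y) < c + inverse (Suc n)" for n
  proof -
    have "\<U> \<inter> \<V> \<subseteq> \<U> \<inter> range (\<Phi> n)" by (auto simp: \<V>)
    then obtain Y where "Y \<in> \<U> \<inter> range (\<Phi> n)" "norm (T - Y) < c + inverse (Suc n)"
      unfolding c_def
      by (rule approximation_in_inter_range[OF masa U \<Phi> k l _ ne, of n "inverse (Suc n)"]) auto
    then show ?thesis by blast
  qed
  then obtain Y where Y: "\<And>n. Y n \<in> \<U> \<inter> range (\<Phi> n)" "\<And>n. norm (T - Y n) < c + inverse (Suc n)"
    by metis
  have "norm (Y n) \<le> norm T + (c + 1)" for n
  proof -
    have "inverse (real (Suc n)) \<le> 1" by (simp add: field_simps)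
    then show ?thesis using Y(2)[of n] norm_triangle_ineq2[of "Y n" T]
      by (simp add: norm_minus_commute)
  qed
  then obtain r S where r: "strict_mono r" and S: "limitin weak_star (Y \<circ> r) S sequentially"
    by (rule bounded_imp_weak_star_subsequence[OF separable, of Y "norm T + (c + 1)"]) auto
  have "S \<in> \<U>" using Y(1) by (intro limitin_closedin[OF S closed(1)]) auto
  \<comment> \<open>From index \<open>m\<close> on, the subsequence stays in the weak* closed set
    \<open>range (\<Phi> m)\<close>, because \<open>r n\<close> is at least \<open>n\<close> and the
    ranges decrease.\<close>
  moreover have "S \<in> range (\<Phi> m)" for m
  proof (rule limitin_closedin[OF S closed(2)])
    show "eventually (\<lambda>n. (Y \<circ> r) n \<in> range (\<Phi> m)) sequentially"
      using eventually_ge_at_top[of m]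
    proof eventually_elim
      case (elim n)
      then have "m \<le> r n" using seq_suble[OF r, of n] by linarith
      from H_approximation_range_antimono[OF masa V this] Y(1)[of "r n"] show ?case by auto
    qed
  qed simp
  ultimately have SW: "S \<in> \<U> \<inter> \<V>" by (auto simp: \<V>)
  have "norm (T - S) \<le> c"
  proof (rule field_le_epsilon)
    fix e :: real assume e: "0 < e"
    show "norm (T - S) \<le> c + e"
    proof (rule norm_limitin_weak_star_le[OF S])
      have "eventually (\<lambda>n. inverse (real (Suc n)) < e) sequentially"
        using order_tendstoD(2)[OF LIMSEQ_inverse_real_of_nat e] .
      then have "eventually (\<lambda>n. inverse (real (Suc (r n))) < e) sequentially"
        using filterlim_subseq[OF r] by (auto simp: filterlim_iff)
      then show "eventually (\<lambda>n. norm (T - (Y \<circ> r) n) \<le> c + e) sequentially"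
      proof eventually_elim
        case (elim n)
        then show ?case using Y(2)[of "r n"] by simp
      qed
    qed (use c e in auto)
  qed
  then show ?thesis using infdist_le[OF SW, of T] by (simp add: c_def dist_norm)
qed

section \<open>From admissible bounds to the optimal constants\<close>

text \<open>Admissible constants are upward closed since \<open>alpha\<close> is nonnegative, so
  every \<open>k\<close> strictly above the infimum is admissible. The infimum itself may fail to
  be: it is \<open>0\<close>, which is not positive, for the whole algebra.\<close>

lemma less_hyperreflexivity_constantD:
  fixes \<X> :: "'a::chilbert_space bop set"
  assumes "hyperreflexive \<X>" "hyperreflexivity_constant \<X> < k"
  shows "0 < k" "infdist T \<X> \<le> k * alpha T \<X>"
proof -
  let ?K = "{k. k > 0 \<and> (\<forall>T. infdist T \<X> \<le> k * alpha T \<X>)}"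
  have "?K \<noteq> {}" "\<X> \<noteq> {}"
    using assms(1)
    by (auto simp: hyperreflexive_def weak_star_closed_subspace_def complex_vector.subspace_def)
  then obtain k' where k': "k' \<in> ?K" "k' < k"
    using cInf_lessD[of ?K k] assms(2) by (auto simp: hyperreflexivity_constant_def)
  then show "0 < k" by simp
  have "infdist T \<X> \<le> k' * alpha T \<X>" using k'(1) by blast
  also have "\<dots> \<le> k * alpha T \<X>"
    using k'(2) alpha_nonneg[OF \<open>\<X> \<noteq> {}\<close>] by (intro mult_right_mono) auto
  finally show "infdist T \<X> \<le> k * alpha T \<X>" .
qed

lemma less_lambda_constD:
  assumes "\<Phi> \<in> schur_H \<D>" "lambda_const \<Phi> < l"
  shows "0 < l" "norm (T - \<Phi> T) \<le> l * alpha T (range \<Phi>)"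
proof -
  let ?L = "{l. l > 0 \<and> (\<forall>T. norm (T - \<Phi> T) \<le> l * alpha T (range \<Phi>))}"
  have "?L \<noteq> {}" using assms(1) by (auto simp: schur_H_def)
  then obtain l' where l': "l' \<in> ?L" "l' < l"
    using cInf_lessD[of ?L l] assms(2) by (auto simp: lambda_const_def)
  then show "0 < l" by simp
  have "norm (T - \<Phi> T) \<le> l' * alpha T (range \<Phi>)" using l'(1) by blast
  also have "\<dots> \<le> l * alpha T (range \<Phi>)"
    using l'(2) alpha_nonneg[of "range \<Phi>"] by (intro mult_right_mono) auto
  finally show "norm (T - \<Phi> T) \<le> l * alpha T (range \<Phi>)" .
qed

text \<open>Some approximating sequence has its supremum of constants below \<open>l\<close>, so one
  \<open>l\<close> is admissible for all its members at once.\<close>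

lemma less_lambda_HD:
  assumes "approx_H_injective \<D> \<V>" "lambda_H \<D> \<V> < l"
  obtains \<Phi> where "H_approximation \<D> \<V> \<Phi>" "0 < l"
    "\<And>n T. norm (T - \<Phi> n T) \<le> l * alpha T (range (\<Phi> n))"
proof -
  let ?L = "{(SUP n. lambda_const (\<Phi> n)) | \<Phi>. H_approximation \<D> \<V> \<Phi>}"
  have "?L \<noteq> {}" using assms(1) by (auto simp: approx_H_injective_def)
  then obtain \<Phi> where \<Phi>: "H_approximation \<D> \<V> \<Phi>" "(SUP n. lambda_const (\<Phi> n)) < l"
    using cInf_lessD[of ?L l] assms(2) by (auto simp: lambda_H_def)
  have H: "\<Phi> n \<in> schur_H \<D>" and bdd: "bdd_above (range (\<lambda>n. lambda_const (\<Phi> n)))" for n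
    using \<Phi>(1) by (auto simp: H_approximation_def)
  have "lambda_const (\<Phi> n) < l" for n
    using cSUP_upper[OF UNIV_I bdd, of n] \<Phi>(2) by linarith
  then show ?thesis using less_lambda_constD[OF H] by (intro that[OF \<Phi>(1)]) auto
qed

theorem theorem5p2:
  fixes \<D> \<U> \<V> :: "'a::chilbert_space bop set"
  assumes separable: "\<exists>S :: 'a set. countable S \<and> closure S = UNIV"
    and masa: "masa \<D>"
    and V: "approx_H_injective \<D> \<V>"
    and U: "masa_bimodule \<D> \<U>" "hyperreflexive \<U>"
  shows "hyperreflexive (\<U> \<inter> \<V>) \<and>
    hyperreflexivity_constant (\<U> \<inter> \<V>) \<le>
      lambda_H \<D> \<V> + hyperreflexivity_constant \<U> + lambda_H \<D> \<V> * hyperreflexivity_constant \<U>"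
proof -
  let ?l = "lambda_H \<D> \<V>" and ?k = "hyperreflexivity_constant \<U>"
  let ?K = "{k. k > 0 \<and> (\<forall>T. infdist T (\<U> \<inter> \<V>) \<le> k * alpha T (\<U> \<inter> \<V>))}"
  \<comment> \<open>Both infima are enlarged by \<open>e\<close> to obtain admissible constants; the
    claimed bound is the limit of \<open>c e\<close> as \<open>e\<close> decreases to
    \<open>0\<close>.\<close>
  define c where "c e = (?l + e) + (?k + e) + (?l + e) * (?k + e)" for e
  have K: "c e \<in> ?K" if "0 < e" for e
  proof -
    have "?l < ?l + e" "?k < ?k + e" using that by auto
    obtain \<Phi> where \<Phi>: "H_approximation \<D> \<V> \<Phi>" and l: "0 < ?l + e"
      "\<And>n T. norm (T - \<Phi> n T) \<le> (?l + e) * alpha T (range (\<Phi> n))"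
      by (rule less_lambda_HD[OF V \<open>?l < ?l + e\<close>]) auto
    have k: "0 < ?k + e" "infdist T \<U> \<le> (?k + e) * alpha T \<U>" for T
      using less_hyperreflexivity_constantD[OF U(2) \<open>?k < ?k + e\<close>] by auto
    have "0 < c e" unfolding c_def using mult_pos_pos[OF l(1) k(1)] k(1) l(1) by linarith
    then show ?thesis
      using infdist_inter_le[OF separable masa U \<Phi> k l] by (simp add: c_def)
  qed
  have "weak_star_closed_subspace (\<U> \<inter> \<V>)"
    using U(1) V
    by (auto simp: approx_H_injective_def masa_bimodule_def weak_star_closed_subspace_def
        intro: complex_vector.subspace_inter)
  then have "hyperreflexive (\<U> \<inter> \<V>)"
    using K[of 1] by (auto simp: hyperreflexive_def)
  moreover have "hyperreflexivity_constant (\<U> \<inter> \<V>) \<le> ?l + ?k + ?l * ?k"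
  proof (rule tendsto_lowerbound)
    have "(c \<longlongrightarrow> (?l + 0) + (?k + 0) + (?l + 0) * (?k + 0)) (at_right 0)"
      unfolding c_def by (intro tendsto_intros)
    then show "(c \<longlongrightarrow> ?l + ?k + ?l * ?k) (at_right 0)" by simp
    have "hyperreflexivity_constant (\<U> \<inter> \<V>) \<le> c e" if "0 < e" for e
      unfolding hyperreflexivity_constant_def
      using K[OF that] by (intro cInf_lower bdd_belowI[of _ 0]) auto
    then show "eventually (\<lambda>e. hyperreflexivity_constant (\<U> \<inter> \<V>) \<le> c e) (at_right 0)"
      by (auto simp: eventually_at_right_field intro!: exI[of _ 1])
  qed simp
  ultimately show ?thesis by blast
qed

end
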